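(* Let $A,B$ be real symmetric $4\times 4$ matrices defining quadrics $\mathcal A: X^TAX=0$, $\mathcal B: X^TBX=0$ in $\mathbb{PR}^3$ with $f(\lambda)=\det(\lambda A-B)$ not identically zero. If $f(\lambda)=0$ has one double root and a pair of complex conjugate roots, with Segre characteristic $[211]$, then the only possible index sequence is $\langle 2\,{\wr\wr}_{-}\,2\rangle$ (or its equivalent $\langle 2\,{\wr\wr}_{+}\,2\rangle$), and in this case the QSIC comprises one open component with a crunode.
   Context: $X=(x,y,z,w)^T$ homogeneous coordinates; QSIC $=\mathcal A\cap\mathcal B$. One may choose the basis of the pencil with $A$ nonsingular. Canonical form: for $A$ nonsingular there is a real invertible $Q$ with $Q^TAQ=\mathrm{diag}(\varepsilon_1E_1,\dots,\varepsilon_rE_r,E_{r+1},\dots,E_m)$, $Q^TBQ=\mathrm{diag}(\varepsilon_1E_1J_1,\dots,\varepsilon_rE_rJ_r,E_{r+1}J_{r+1},\dots,E_mJ_m)$, $J_1,\dots,J_r$ the real Jordan blocks of $A^{-1}B$ for real eigenvalues, $J_{r+1},\dots$ those for non-real eigenvalues, $E_i$ anti-identity of the size of $J_i$, $\varepsilon_i\in\{\pm1\}$ uniquely determined; $\varepsilon_i$ is the sign of $J_i$. Segre characteristic $[211]$: the double root has a single $2\times2$ Jordan block, the two other roots have $1\times1$ blocks. $\mathrm{Id}(\lambda)$ = number of positive eigenvalues of $\lambda A-B$. Index sequence: $\langle s_0\sigma_1s_1\cdots\sigma_rs_r\rangle$ with $s_j$ the values of $\mathrm{Id}$ on the intervals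 cut out by the distinct real roots $\lambda_1<\dots<\lambda_r$, and $\sigma_j$ encoding the Jordan blocks of $\lambda_j$: $|$ for a $1\times1$ block, $p$ copies of $\wr$ with subscript the block's sign for a $p\times p$ block, $p\ge2$. Sequences are considered up to the equivalence induced by changing the basis of the pencil (rotation, reversal, and complement $s_j\mapsto 4-s_j$, the last coming from $(A,B)\mapsto(-A,-B)$ and reversing signs). A real component is open if it meets every real plane of $\mathbb{PR}^3$, closed otherwise. A crunode is a real double point with two real branches. *)

theory Defs
  imports "HOL-Analysis.Analysis" "HOL-Computational_Algebra.Polynomial"
begin

type_synonym mat4 = "real^4^4"
type_synonym vec4 = "real^4"

definition symmetric_mat :: "mat4 \<Rightarrow> bool" where
  "symmetric_mat M \<longleftrightarrow> transpose M = M"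

definition charpoly :: "real^'n^'n \<Rightarrow> real poly" where
  "charpoly M = det (\<chi> i j. (if i = j then [:0, 1:] else 0) - [:M $ i $ j:])"

definition num_pos_eigenvalues :: "real^'n^'n \<Rightarrow> nat" where
  "num_pos_eigenvalues M =
     (\<Sum>x\<in>{x::real. 0 < x \<and> poly (charpoly M) x = 0}. order x (charpoly M))"

definition Id_pencil :: "mat4 \<Rightarrow> mat4 \<Rightarrow> real \<Rightarrow> nat" where
  "Id_pencil A B l = num_pos_eigenvalues (l *\<^sub>R A - B)"

definition num_jordan_blocks :: "real^'n^'n \<Rightarrow> real \<Rightarrow> nat" where
  "num_jordan_blocks M r = dim {v. M *v v = r *\<^sub>R v}"

text \<open>We model real projective 3-space PR^3 by the standard embedding sending the
  point [X] to the orthogonal projection X X^T / (X^T X) (a homeomorphism onto its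
  image); the topology on PR^3 is then the Euclidean one on real^4^4.\<close>
definition proj_pt :: "vec4 \<Rightarrow> mat4" where
  "proj_pt X = (\<chi> i j. X $ i * X $ j / (X \<bullet> X))"

definition on_quadric :: "mat4 \<Rightarrow> vec4 \<Rightarrow> bool" where
  "on_quadric M X \<longleftrightarrow> X \<bullet> (M *v X) = 0"

definition qsic :: "mat4 \<Rightarrow> mat4 \<Rightarrow> mat4 set" where
  "qsic A B = {proj_pt X | X. X \<noteq> 0 \<and> on_quadric A X \<and> on_quadric B X}"

definition qsic_components :: "mat4 \<Rightarrow> mat4 \<Rightarrow> mat4 set set" where
  "qsic_components A B = {connected_component_set (qsic A B) p | p. p \<in> qsic A B}"

definition open_component :: "mat4 set \<Rightarrow> bool" where
  "open_component K \<longleftrightarrow>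
     (\<forall>n::vec4. n \<noteq> 0 \<longrightarrow> (\<exists>X. X \<noteq> 0 \<and> n \<bullet> X = 0 \<and> proj_pt X \<in> K))"

text \<open>Double point of the QSIC: a point where the Jacobian of the two defining forms
  has rank exactly 1 (rank 0 would mean every quadric of the pencil is singular there,
  i.e. a point of multiplicity 4).\<close>
definition double_point :: "mat4 \<Rightarrow> mat4 \<Rightarrow> vec4 \<Rightarrow> bool" where
  "double_point A B X \<longleftrightarrow> X \<noteq> 0 \<and> on_quadric A X \<and> on_quadric B X \<and>
     dim (span {A *v X, B *v X}) = 1"

definition crunode :: "mat4 \<Rightarrow> mat4 \<Rightarrow> vec4 \<Rightarrow> bool" where
  "crunode A B X \<longleftrightarrow> double_point A B X \<and>
     (\<exists>U g1 g2 d1 d2. open U \<and> proj_pt X \<in> U \<and>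
        arc g1 \<and> arc g2 \<and>
        path_image g1 \<subseteq> qsic A B \<and> path_image g2 \<subseteq> qsic A B \<and>
        g1 (1/2) = proj_pt X \<and> g2 (1/2) = proj_pt X \<and>
        path_image g1 \<inter> path_image g2 = {proj_pt X} \<and>
        (g1 has_vector_derivative d1) (at (1/2)) \<and>
        (g2 has_vector_derivative d2) (at (1/2)) \<and>
        independent {d1, d2} \<and> d1 \<noteq> d2 \<and>
        qsic A B \<inter> U = (path_image g1 \<union> path_image g2) \<inter> U)"

end

theory Submission
  imports Defs
begin

text \<open>
  Put $N = B - rA$, so that $X^TAX = X^TBX = 0$ becomes $X^TAX = X^TNX = 0$, and let $X$ span the
  kernel of $N$. Since $r$ is the only real eigenvalue of $A^{-1}B$, the vector $X$ is null for $A$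
  and $NY = AX$ is solvable; the real and imaginary parts $p, q$ of an eigenvector for $z$ complete
  $X, Y$ to a basis. Multiplying $p + iq$ by a suitable complex number and rescaling gives
  coordinates $(x,y,s,t)$ in which
  $N = c\,(y^2 - st)$ and $A = \rho\,(2xy + s^2 - t^2) + 2\sigma\,(st - y^2)$ with $c, \rho \neq 0$.
  Hence every such QSIC is projectively the rational quartic
  $y^2 = st$, $2xy = t^2 - s^2$, parametrised by
  $[u:v] \mapsto [(v^4-u^4)/2 : u^2v^2 : u^3v : uv^3]$. It is connected, its two parameters $u = 0$
  and $v = 0$ give the node, and a linear form takes opposite values there, so it vanishes somewhere
  on the curve. Every form $\lambda A - B$ with $\lambda \neq r$ is nondegenerate with a totally
  isotropic plane, so its signature is $(2,2)$.
\<close>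

section \<open>Signature of a symmetric matrix\<close>

lemma det_nz_iff_ker:
  fixes A :: "'a::field^'n^'n"
  shows "det A \<noteq> 0 \<longleftrightarrow> (\<forall>x. A *v x = 0 \<longrightarrow> x = 0)"
  unfolding invertible_det_nz[symmetric] invertible_left_inverse matrix_left_invertible_ker ..

lemma symmetric_dot:
  fixes M :: "real^'n^'n"
  assumes "transpose M = M"
  shows "x \<bullet> (M *v y) = y \<bullet> (M *v x)"
  by (metis assms dot_lmul_matrix inner_commute vector_transpose_matrix)

text \<open>A maximiser \<open>v\<close> of the quadratic form on the unit sphere of
  \<open>S\<close> is an eigenvector: \<open>g\<close> is nonnegative on \<open>S\<close> and
  vanishes at \<open>v\<close>, so its first variation at \<open>v\<close> along \<open>h\<close>
  must vanish, and this variation is \<open>2 * (h \<bullet> h)\<close>.\<close>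

lemma symmetric_eigenvector_exists:
  fixes M :: "real^'n^'n"
  assumes M: "transpose M = M" and S: "subspace S" and inv: "\<And>v. v \<in> S \<Longrightarrow> M *v v \<in> S"
    and nz: "S \<noteq> {0}"
  obtains v l where "v \<in> S" "norm v = 1" "M *v v = l *\<^sub>R v"
proof -
  let ?C = "sphere 0 1 \<inter> S"
  obtain s where s: "s \<in> S" "s \<noteq> 0"
    using nz S subspace_0 by blast
  have "(1 / norm s) *\<^sub>R s \<in> ?C"
    using s S by (simp add: subspace_scale)
  moreover have "compact ?C"
    by (intro compact_Int_closed compact_sphere closed_subspace S)
  moreover have "continuous_on ?C (\<lambda>x. x \<bullet> (M *v x))"
    by (intro continuous_intros)
  ultimately obtain v where v: "v \<in> ?C" and max: "\<And>y. y \<in> ?C \<Longrightarrow> y \<bullet> (M *v y) \<le> v \<bullet> (M *v v)"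
    using continuous_attains_sup[of ?C "\<lambda>x. x \<bullet> (M *v x)"] by blast
  define l where "l = v \<bullet> (M *v v)"
  have vS: "v \<in> S" and vn: "norm v = 1" and vv: "v \<bullet> v = 1"
    using v by (auto simp: norm_eq_1)
  define g where "g x = l * (x \<bullet> x) - x \<bullet> (M *v x)" for x
  have g_nonneg: "g x \<ge> 0" if "x \<in> S" for x
  proof (cases "x = 0")
    case False
    have "(1 / norm x) *\<^sub>R x \<in> ?C"
      using that False S by (simp add: subspace_scale)
    from max[OF this] have "(x \<bullet> (M *v x)) / (norm x)^2 \<le> l"
      by (simp add: l_def matrix_vector_mult_scaleR power2_eq_square)
    then show ?thesis
      using False by (simp add: g_def divide_simps power2_norm_eq_inner split: if_splits)
  qed (simp add: g_def)
  define h where "h = l *\<^sub>R v - M *v v"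
  have hS: "h \<in> S"
    unfolding h_def using S inv vS by (simp add: subspace_diff subspace_scale)
  have gv: "g v = 0" by (simp add: g_def l_def vv)
  have "g (v + t *\<^sub>R h) = g v + 2 * t * (h \<bullet> (l *\<^sub>R v - M *v v)) + t^2 * g h" for t
    using symmetric_dot[OF M, of v h] inner_commute[of v h]
    by (simp add: g_def matrix_vector_mult_scaleR matrix_vector_right_distrib
        inner_add_left inner_add_right inner_diff_right power2_eq_square distrib_left right_diff_distrib)
  then have expand: "g (v + t *\<^sub>R h) = 2 * t * (h \<bullet> h) + t^2 * g h" for t
    by (simp add: gv flip: h_def)
  have key: "2 * t * (h \<bullet> h) + t^2 * g h \<ge> 0" for t
    using g_nonneg[of "v + t *\<^sub>R h"] hS vS S by (simp add: expand subspace_add subspace_scale)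
  have "h \<bullet> h = 0"
  proof (rule ccontr)
    assume "h \<bullet> h \<noteq> 0"
    then have p: "h \<bullet> h > 0" by simp
    have q: "g h \<ge> 0" using g_nonneg hS by blast
    \<comment> \<open>A negative \<open>t\<close> so small that the linear term in \<open>t\<close>
      outweighs the quadratic one; the \<open>+ 1\<close> keeps the denominator positive when
      \<open>g h = 0\<close>.\<close>
    define t where "t = - (h \<bullet> h) / (g h + 1)"
    have "2 * t * (h \<bullet> h) + t^2 * g h < 0"
    proof -
      have "2 * t * (h \<bullet> h) + t^2 * g h = t * (2 * (h \<bullet> h) + t * g h)"
        by (simp add: power2_eq_square algebra_simps)
      moreover have "t < 0" unfolding t_def using p q by (simp add: divide_neg_pos)
      moreover have "- t * g h \<le> h \<bullet> h"
        unfolding t_def using p q by (simp add: divide_simps algebra_simps)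
      moreover from this have "0 < 2 * (h \<bullet> h) + t * g h" using p by linarith
      ultimately show ?thesis using mult_neg_pos[of t "2 * (h \<bullet> h) + t * g h"] by linarith
    qed
    then show False using key[of t] by simp
  qed
  then have "M *v v = l *\<^sub>R v" by (simp add: h_def)
  then show ?thesis using that vS vn by blast
qed

text \<open>Induction on the dimension: a unit eigenvector is split off, and by symmetry its
  orthogonal complement in \<open>S\<close> is again invariant. Arbitrary invariant subspaces appear
  in the statement so that this complement is an instance of it.\<close>

lemma symmetric_orthonormal_eigenbasis:
  fixes M :: "real^'n^'n"
  assumes M: "transpose M = M" and "subspace S" and "\<And>v. v \<in> S \<Longrightarrow> M *v v \<in> S"
  shows "\<exists>B. pairwise orthogonal B \<and> (\<forall>b\<in>B. norm b = 1) \<and> span B = S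
           \<and> (\<forall>b\<in>B. \<exists>l. M *v b = l *\<^sub>R b)"
  using assms(2,3)
proof (induction "dim S" arbitrary: S rule: less_induct)
  case less
  show ?case
  proof (cases "S = {0}")
    case True
    then show ?thesis by (intro exI[of _ "{}"]) auto
  next
    case False
    obtain v l where v: "v \<in> S" "norm v = 1" "M *v v = l *\<^sub>R v"
      using symmetric_eigenvector_exists[OF M less.prems False] by blast
    let ?T = "{x \<in> S. orthogonal v x}"
    have vnT: "v \<notin> ?T" using v(2) by (auto simp: orthogonal_def norm_eq_1)
    have T: "subspace ?T"
      using less.prems(1) by (auto simp: subspace_def orthogonal_def inner_add_right)
    have "dim ?T < dim S"
    proof -
      have "?T \<subset> S" using v vnT by blast
      then show ?thesis
        using T less.prems(1) by (metis dim_psubset span_eq_iff)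
    qed
    moreover have "M *v x \<in> ?T" if "x \<in> ?T" for x
      using that less.prems(2) v symmetric_dot[OF M, of v x] by (auto simp: orthogonal_def inner_commute)
    ultimately obtain B where B: "pairwise orthogonal B" "\<forall>b\<in>B. norm b = 1" "span B = ?T"
        "\<forall>b\<in>B. \<exists>l. M *v b = l *\<^sub>R b"
      using less.hyps[OF _ T] by blast
    have BT: "B \<subseteq> ?T" using B(3) span_superset by blast
    have "span (insert v B) = S"
    proof
      show "span (insert v B) \<subseteq> S"
        using BT v(1) less.prems(1) by (intro span_minimal) auto
      show "S \<subseteq> span (insert v B)"
      proof
        fix x assume "x \<in> S"
        then have "x - (v \<bullet> x) *\<^sub>R v \<in> ?T"
          using v less.prems(1) by (auto simp: subspace_diff subspace_scale orthogonal_def inner_diff_right norm_eq_1)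
        then show "x \<in> span (insert v B)"
          unfolding span_breakdown_eq B(3) by blast
      qed
    qed
    moreover have "pairwise orthogonal (insert v B)"
      using B(1) BT by (auto simp: pairwise_insert orthogonal_commute)
    ultimately show ?thesis
      using B v by (intro exI[of _ "insert v B"]) auto
  qed
qed

section \<open>Characteristic polynomial and the number of positive eigenvalues\<close>

lemma poly_det: "poly (det P) x = det (\<chi> i j. poly (P $ i $ j) x)"
  for P :: "'a::comm_ring_1 poly^'n^'n"
  by (simp add: det_def poly_sum poly_prod poly_mult)

lemma poly_charpoly: "poly (charpoly M) x = det (mat x - M)"
  by (simp add: charpoly_def poly_det mat_def minus_vec_def if_distrib[of "\<lambda>p. poly p x"] if_distrib[of "\<lambda>p. p - _"] cong: if_cong)

lemma order_prod_linear:
  fixes d :: "'b \<Rightarrow> 'a::idom"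
  assumes "finite I"
  shows "order x (\<Prod>i\<in>I. [:- d i, 1:]) = card {i\<in>I. d i = x}"
  using assms
proof (induction I)
  case (insert j I)
  let ?q = "\<Prod>i\<in>I. [:- d i, 1:]"
  have "[:- d j, 1:] * ?q \<noteq> 0"
    using insert.hyps by (auto simp: prod_zero_iff simp del: mult_pCons_left)
  then have "order x ([:- d j, 1:] * ?q) = order x [:- d j, 1:] + order x ?q"
    by (rule order_mult)
  moreover have "order x [:- d j, 1:] = (if d j = x then 1 else 0)"
    using order_power_n_n[of "d j" 1] by (auto intro: order_0I)
  moreover have "{i \<in> insert j I. d i = x} = (if d j = x then insert j {i\<in>I. d i = x} else {i\<in>I. d i = x})"
    by auto
  ultimately show ?case
    using insert by (simp del: mult_pCons_left)
qed (simp add: order_0I)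

text \<open>Bridges two counts: \<open>num_pos_eigenvalues\<close> adds up root multiplicities of
  the characteristic polynomial, whereas signature arguments count vectors of an eigenbasis. Both
  agree because the polynomial splits into the factors \<open>x - d i\<close>.\<close>

lemma symmetric_diagonalization:
  fixes M :: "real^'n^'n"
  assumes M: "transpose M = M"
  obtains f :: "'n \<Rightarrow> real^'n" and d
  where "inj f" "independent (range f)" "pairwise orthogonal (range f)"
    "\<And>i. norm (f i) = 1" "\<And>i. M *v f i = d i *\<^sub>R f i"
    "num_pos_eigenvalues M = card {i. d i > 0}"
proof -
  obtain B where B: "pairwise orthogonal B" "\<forall>b\<in>B. norm b = 1" "span B = UNIV"
      "\<forall>b\<in>B. \<exists>l. M *v b = l *\<^sub>R b"
    using symmetric_orthonormal_eigenbasis[OF M, of UNIV] by auto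
  have indep: "independent B"
    using B(1,2) by (intro pairwise_orthogonal_independent) auto
  have "card B = CARD('n)"
    using B(3) indep by (metis dim_UNIV dim_eq_card dim_span DIM_cart DIM_real mult.right_neutral)
  then obtain f where f: "bij_betw f (UNIV::'n set) B"
    using indep by (metis finite_class.finite_UNIV finiteI_independent finite_same_card_bij)
  then have range: "range f = B" and inj: "inj f" by (auto simp: bij_betw_def)
  have "\<forall>i. \<exists>l. M *v f i = l *\<^sub>R f i" using B(4) range by blast
  then obtain d where d: "\<And>i. M *v f i = d i *\<^sub>R f i" by metis
  define P where "P = (\<chi> i j. f j $ i)"
  have col: "column j P = f j" for j by (simp add: column_def P_def)
  have detP: "det P \<noteq> 0"
  proof -
    have "rank P = CARD('n)"
      unfolding column_rank_def columns_def col
      using range B(3) by (simp add: full_SetCompr_eq) (metis dim_UNIV dim_span DIM_cart DIM_real mult.right_neutral)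
    then show ?thesis by (simp add: det_eq_0_rank)
  qed
  have "poly (charpoly M) x = poly (\<Prod>i\<in>UNIV. [:- d i, 1:]) x" for x
  proof -
    let ?D = "\<chi> i j. if i = j then x - d i else 0"
    have "((mat x - M) ** P) $ i $ j = (P ** ?D) $ i $ j" for i j
    proof -
      have "((mat x - M) ** P) $ i $ j = ((mat x - M) *v column j P) $ i"
        by (simp add: matrix_matrix_mult_def matrix_vector_mult_def column_def)
      also have "\<dots> = x * f j $ i - (M *v f j) $ i"
        by (simp add: col matrix_vector_mult_diff_rdistrib) (simp add: matrix_vector_mult_def mat_def if_distrib[of "\<lambda>t. t * _"] sum.delta' cong: if_cong)
      also have "\<dots> = (P ** ?D) $ i $ j"
        by (simp add: d matrix_matrix_mult_def P_def sum.delta' if_distrib[of "\<lambda>t. _ * t"] algebra_simps cong: if_cong)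
      finally show ?thesis .
    qed
    then have "(mat x - M) ** P = P ** ?D" by (simp add: vec_eq_iff)
    \<comment> \<open>\<open>P\<close> has the eigenvectors as columns and is invertible, so
      \<open>det P\<close> can be cancelled.\<close>
    then have "det (mat x - M) * det P = det P * det ?D"
      unfolding det_mul[symmetric] by (rule arg_cong)
    moreover have "det ?D = (\<Prod>i\<in>UNIV. x - d i)" by (subst det_diagonal) auto
    ultimately show ?thesis
      using detP by (simp add: poly_charpoly poly_prod)
  qed
  then have cp: "charpoly M = (\<Prod>i\<in>UNIV. [:- d i, 1:])"
    using poly_eq_poly_eq_iff by blast
  have roots: "{x. 0 < x \<and> poly (charpoly M) x = 0} = d ` {i. 0 < d i}"
    by (auto simp: cp poly_prod)
  \<comment> \<open>The indices with positive \<open>d i\<close> are grouped by the value of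
    \<open>d\<close>; each group has the size of the multiplicity of that root.\<close>
  have "num_pos_eigenvalues M = (\<Sum>x\<in>d ` {i. 0 < d i}. card {i. d i = x})"
    unfolding num_pos_eigenvalues_def roots unfolding cp by (simp add: order_prod_linear)
  also have "\<dots> = (\<Sum>x\<in>d ` {i. 0 < d i}. card {i \<in> {i. 0 < d i}. d i = x})"
    by (intro sum.cong refl arg_cong[of _ _ card]) auto
  also have "\<dots> = card {i. 0 < d i}"
    using sum.image_gen[of "{i. 0 < d i}" "\<lambda>_. 1::nat" d] by simp
  finally have "num_pos_eigenvalues M = card {i. 0 < d i}" .
  moreover have "norm (f i) = 1" for i using B(2) range by blast
  ultimately show ?thesis
    using that[of f d] inj d indep B(1) range by blast
qed

text \<open>The form is definite on the span of the eigenvectors of one sign, so this span meets the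
  null space \<open>Z\<close> only in 0. Hence at most half of the eigenvalues have each sign; as
  none is zero, exactly half of them are positive.\<close>

lemma num_pos_eigenvalues_half_null:
  fixes M :: "real^'n^'n"
  assumes M: "transpose M = M" and det: "det M \<noteq> 0"
    and Z: "subspace Z" and null: "\<And>x. x \<in> Z \<Longrightarrow> x \<bullet> (M *v x) = 0"
    and dimZ: "2 * dim Z = CARD('n)"
  shows "num_pos_eigenvalues M = dim Z"
proof -
  obtain f :: "'n \<Rightarrow> real^'n" and d where f: "inj f" "independent (range f)" "pairwise orthogonal (range f)"
    "\<And>i. norm (f i) = 1" "\<And>i. M *v f i = d i *\<^sub>R f i"
    and num: "num_pos_eigenvalues M = card {i. d i > 0}"
    using symmetric_diagonalization[OF M] by blast
  have orth: "f i \<bullet> f j = (if i = j then 1 else 0)" for i j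
    using f(1,3,4) by (auto simp: pairwise_def orthogonal_def inj_eq norm_eq_1)
  have form: "(\<Sum>i\<in>I. u i *\<^sub>R f i) \<bullet> (M *v (\<Sum>i\<in>I. u i *\<^sub>R f i)) = (\<Sum>i\<in>I. d i * (u i)\<^sup>2)" for u and I :: "'n set"
    by (simp add: linear_sum[OF matrix_vector_mul_linear] matrix_vector_mult_scaleR f(5) inner_sum_left
        inner_sum_right orth sum.delta' if_distrib[of "\<lambda>t. _ * t"] power2_eq_square algebra_simps cong: if_cong)
  have d_nz: "d i \<noteq> 0" for i
  proof
    assume "d i = 0"
    then have "M *v f i = 0" using f(5)[of i] by simp
    then have "f i = 0" using det unfolding det_nz_iff_ker by blast
    then show False using f(4)[of i] by simp
  qed
  have bound: "card I + dim Z \<le> CARD('n)" if sgn: "(\<forall>i\<in>I. d i > 0) \<or> (\<forall>i\<in>I. d i < 0)" for I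
  proof -
    have dimI: "dim (span (f ` I)) = card I"
      using f(1,2) by (simp add: dim_eq_card_independent independent_mono card_image inj_on_subset image_mono)
    have "span (f ` I) \<inter> Z \<subseteq> {0}"
    proof
      fix x assume x: "x \<in> span (f ` I) \<inter> Z"
      then obtain w where "x = (\<Sum>v\<in>f ` I. w v *\<^sub>R v)"
        by (auto simp: span_finite)
      then have xe: "x = (\<Sum>i\<in>I. w (f i) *\<^sub>R f i)"
        using f(1) by (simp add: sum.reindex inj_on_subset)
      have z: "(\<Sum>i\<in>I. d i * (w (f i))\<^sup>2) = 0"
        using null[of x] x form[of "\<lambda>i. w (f i)" I] unfolding xe by auto
      have "\<forall>i\<in>I. d i * (w (f i))\<^sup>2 = 0"
        using sgn
      proof
        assume "\<forall>i\<in>I. d i > 0"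
        then show ?thesis using z by (subst (asm) sum_nonneg_eq_0_iff) (auto simp: less_imp_le)
      next
        assume "\<forall>i\<in>I. d i < 0"
        moreover have "(\<Sum>i\<in>I. - (d i * (w (f i))\<^sup>2)) = 0" using z by (simp add: sum_negf)
        ultimately show ?thesis 
          by (subst (asm) sum_nonneg_eq_0_iff) (auto simp: mult_nonpos_nonneg less_imp_le)
      qed
      then have "x = 0" using d_nz by (simp add: xe)
      then show "x \<in> {0}" by simp
    qed
    then have "dim (span (f ` I) \<inter> Z) = 0"
      by (simp add: dim_eq_0)
    moreover have "dim {x + y |x y. x \<in> span (f ` I) \<and> y \<in> Z} \<le> CARD('n)"
      using dim_subset_UNIV[where 'a="real^'n"] by simp
    ultimately show ?thesis
      using dim_sums_Int[OF subspace_span Z, of "f ` I"] dimI by linarith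
  qed
  have "card {i. d i > 0} + card {i. d i < 0} = card ({i. d i > 0} \<union> {i. d i < 0})"
    by (rule card_Un_disjoint[symmetric]) auto
  also have "{i. d i > 0} \<union> {i. d i < 0} = UNIV" using d_nz by (auto simp: neq_iff)
  finally have "card {i. d i > 0} + card {i. d i < 0} = CARD('n)" .
  then show ?thesis
    using bound[of "{i. d i > 0}"] bound[of "{i. d i < 0}"] dimZ num by auto
qed

section \<open>The projective embedding\<close>

text \<open>\<open>proj_pt X\<close> is the orthogonal projection onto the line of \<open>X\<close>;
  applied to vectors it gives that line back, which makes the embedding injective on projective
  points.\<close>

lemma proj_pt_mult: "proj_pt X *v W = ((X \<bullet> W) / (X \<bullet> X)) *\<^sub>R X"
  by (simp add: vec_eq_iff proj_pt_def matrix_vector_mult_def inner_vec_def sum_distrib_left sum_distrib_right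
      sum_divide_distrib algebra_simps)

lemma proj_pt_scale: "k \<noteq> 0 \<Longrightarrow> proj_pt (k *\<^sub>R X) = proj_pt X"
  by (simp add: vec_eq_iff proj_pt_def)

lemma proj_pt_eqD:
  assumes "proj_pt X = proj_pt Y" "X \<noteq> 0"
  obtains k where "X = k *\<^sub>R Y" "k \<noteq> 0"
proof -
  have "X = ((Y \<bullet> X) / (Y \<bullet> Y)) *\<^sub>R Y"
    using proj_pt_mult[of X X] proj_pt_mult[of Y X] assms by simp
  then show ?thesis using that assms(2) by force
qed

lemma continuous_on_proj_pt:
  assumes "continuous_on S f" "\<And>x. x \<in> S \<Longrightarrow> f x \<noteq> 0"
  shows "continuous_on S (\<lambda>x. proj_pt (f x))"
  unfolding proj_pt_def
  by (intro continuous_on_vec_lambda continuous_intros assms) (simp add: assms(2))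

text \<open>The differential of \<open>proj_pt\<close> at \<open>X\<close> in direction
  \<open>h\<close>, by the quotient rule.\<close>

definition proj_pt_deriv :: "vec4 \<Rightarrow> vec4 \<Rightarrow> mat4" where
  "proj_pt_deriv X h =
     (\<chi> i j. (h $ i * X $ j + X $ i * h $ j) / (X \<bullet> X) - X $ i * X $ j * (2 * (X \<bullet> h)) / (X \<bullet> X)\<^sup>2)"

lemma has_vector_derivative_vec_lambda:
  fixes f :: "real \<Rightarrow> 'a::real_normed_vector^'n"
  assumes "\<And>i. ((\<lambda>t. f t $ i) has_vector_derivative (d $ i)) F"
  shows "(f has_vector_derivative d) F"
  using assms unfolding has_vector_derivative_def has_derivative_def
  by (auto intro!: vec_tendstoI bounded_linear_intros)

lemma has_vector_derivative_proj_pt: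
  assumes c: "(c has_vector_derivative h) (at t)" and nz: "c t \<noteq> 0"
  shows "((\<lambda>t. proj_pt (c t)) has_vector_derivative proj_pt_deriv (c t) h) (at t)"
proof (intro has_vector_derivative_vec_lambda)
  fix i j
  have comp: "((\<lambda>t. c t $ i) has_real_derivative h $ i) (at t)" for i
    using c bounded_linear.has_vector_derivative[OF bounded_linear_vec_nth c, of i]
    by (simp add: has_real_derivative_iff_has_vector_derivative)
  have inner: "((\<lambda>t. c t \<bullet> c t) has_real_derivative 2 * (c t \<bullet> h)) (at t)"
    unfolding inner_vec_def by (auto intro!: derivative_eq_intros comp simp: sum_distrib_left algebra_simps)
  have "((\<lambda>t. c t $ i * c t $ j / (c t \<bullet> c t)) has_real_derivative proj_pt_deriv (c t) h $ i $ j) (at t)"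
    using nz by (auto intro!: derivative_eq_intros comp inner simp: proj_pt_deriv_def power2_eq_square diff_divide_distrib add_divide_distrib algebra_simps)
  then show "((\<lambda>t. proj_pt (c t) $ i $ j) has_vector_derivative proj_pt_deriv (c t) h $ i $ j) (at t)"
    by (simp add: proj_pt_def has_real_derivative_iff_has_vector_derivative)
qed

lemma proj_pt_deriv_linear:
  "a *\<^sub>R proj_pt_deriv X h + b *\<^sub>R proj_pt_deriv X h' = proj_pt_deriv X (a *\<^sub>R h + b *\<^sub>R h')"
  by (simp add: vec_eq_iff proj_pt_deriv_def inner_add_right add_divide_distrib algebra_simps)

lemma proj_pt_deriv_uminus: "proj_pt_deriv (- X) h = - proj_pt_deriv X h"
  by (simp add: vec_eq_iff proj_pt_deriv_def add_divide_distrib diff_divide_distrib algebra_simps)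

text \<open>Only radial directions are killed. Applied to \<open>X\<close>, the matrix
  \<open>proj_pt_deriv X h\<close> gives the component of \<open>h\<close> orthogonal to
  \<open>X\<close>.\<close>

lemma proj_pt_deriv_eq_0:
  assumes "proj_pt_deriv X h = 0" "X \<noteq> 0"
  obtains k where "h = k *\<^sub>R X"
proof -
  have sum: "(\<Sum>j\<in>UNIV. a * (X $ j * X $ j) + b * (X $ j * h $ j) - c * (X $ j * X $ j))
      = a * (X \<bullet> X) + b * (X \<bullet> h) - c * (X \<bullet> X)" for a b c
    by (simp add: inner_vec_def sum.distrib sum_subtractf sum_distrib_left)
  have "(\<Sum>j\<in>UNIV. proj_pt_deriv X h $ i $ j * X $ j) = h $ i - (X \<bullet> h) / (X \<bullet> X) * X $ i" for i
  proof -
    have "(\<Sum>j\<in>UNIV. proj_pt_deriv X h $ i $ j * X $ j) = (\<Sum>j\<in>UNIV. h $ i / (X \<bullet> X) * (X $ j * X $ j)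
        + X $ i / (X \<bullet> X) * (X $ j * h $ j) - X $ i * (2 * (X \<bullet> h)) / (X \<bullet> X)\<^sup>2 * (X $ j * X $ j))"
      by (intro sum.cong refl) (simp add: proj_pt_deriv_def add_divide_distrib algebra_simps)
    also have "\<dots> = h $ i / (X \<bullet> X) * (X \<bullet> X) + X $ i / (X \<bullet> X) * (X \<bullet> h)
        - X $ i * (2 * (X \<bullet> h)) / (X \<bullet> X)\<^sup>2 * (X \<bullet> X)"
      by (rule sum)
    finally show ?thesis using assms(2) by (simp add: power2_eq_square algebra_simps)
  qed
  then have "h = ((X \<bullet> h) / (X \<bullet> X)) *\<^sub>R X"
    using assms(1) by (simp add: vec_eq_iff)
  then show ?thesis by (rule that)
qed

section \<open>The nodal quartic\<close>

text \<open>A basis of the space, stated through coordinates: the quartic can then be studied by its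
  equations in \<open>x, y, s, t\<close>, without moving the quadrics by a projective map.\<close>

locale frame4 =
  fixes e1 e2 e3 e4 :: vec4
  assumes e_span: "\<And>V. \<exists>x y s t. V = x *\<^sub>R e1 + y *\<^sub>R e2 + s *\<^sub>R e3 + t *\<^sub>R e4"
    and e_indep: "\<And>x y s t. x *\<^sub>R e1 + y *\<^sub>R e2 + s *\<^sub>R e3 + t *\<^sub>R e4 = 0 \<Longrightarrow> x = 0 \<and> y = 0 \<and> s = 0 \<and> t = 0"
begin

definition comb where "comb x y s t = x *\<^sub>R e1 + y *\<^sub>R e2 + s *\<^sub>R e3 + t *\<^sub>R e4"

lemma comb_eq_0_iff: "comb x y s t = 0 \<longleftrightarrow> x = 0 \<and> y = 0 \<and> s = 0 \<and> t = 0"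
  using e_indep[of x y s t] by (auto simp: comb_def)

lemma comb_scale: "k *\<^sub>R comb x y s t = comb (k * x) (k * y) (k * s) (k * t)"
  by (simp add: comb_def algebra_simps)

lemma comb_eq_iff: "comb x y s t = comb x' y' s' t' \<longleftrightarrow> x = x' \<and> y = y' \<and> s = s' \<and> t = t'"
proof -
  have "comb x y s t - comb x' y' s' t' = comb (x - x') (y - y') (s - s') (t - t')"
    by (simp add: comb_def algebra_simps)
  then show ?thesis using comb_eq_0_iff[of "x - x'" "y - y'" "s - s'" "t - t'"] by auto
qed

definition curve :: "mat4 set" where
  "curve = {proj_pt (comb x y s t) | x y s t. comb x y s t \<noteq> 0 \<and> y\<^sup>2 = s * t \<and> 2 * x * y = t\<^sup>2 - s\<^sup>2}"

definition \<phi> :: "real \<Rightarrow> real \<Rightarrow> vec4" where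
  "\<phi> u v = comb ((v^4 - u^4) / 2) (u\<^sup>2 * v\<^sup>2) (u^3 * v) (u * v^3)"

lemma \<phi>_eq_0_iff: "\<phi> u v = 0 \<longleftrightarrow> u = 0 \<and> v = 0"
  by (auto simp: \<phi>_def comb_eq_0_iff)

lemma \<phi>_scale: "\<phi> (k * u) (k * v) = k^4 *\<^sub>R \<phi> u v"
  unfolding \<phi>_def comb_scale comb_eq_iff by (simp add: power_mult_distrib algebra_simps power_numeral_reduce)

lemma proj_pt_\<phi>_scale: "k \<noteq> 0 \<Longrightarrow> proj_pt (\<phi> (k * u) (k * v)) = proj_pt (\<phi> u v)"
  by (simp add: \<phi>_scale proj_pt_scale)

lemma continuous_on_\<phi>: 
  assumes "continuous_on S f" "continuous_on S g"
  shows "continuous_on S (\<lambda>x. \<phi> (f x) (g x))"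
  unfolding \<phi>_def comb_def by (intro continuous_intros assms) auto

lemma \<phi>_in_curve:
  assumes "u \<noteq> 0 \<or> v \<noteq> 0"
  shows "proj_pt (\<phi> u v) \<in> curve"
proof -
  have "\<phi> u v \<noteq> 0" using assms by (simp add: \<phi>_eq_0_iff)
  moreover have "(u\<^sup>2 * v\<^sup>2)\<^sup>2 = (u^3 * v) * (u * v^3)"
    by (simp add: power_mult_distrib power_numeral_reduce)
  moreover have "2 * ((v^4 - u^4) / 2) * (u\<^sup>2 * v\<^sup>2) = (u * v^3)\<^sup>2 - (u^3 * v)\<^sup>2"
    by (simp add: power_mult_distrib field_simps)
  ultimately show ?thesis unfolding curve_def \<phi>_def by blast
qed

text \<open>Since \<open>y\<^sup>2 = s * t\<close>, the ratio \<open>s : y\<close>, equal to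
  \<open>y : t\<close>, serves as the parameter \<open>u : v\<close>. If \<open>y = 0\<close> then
  \<open>s\<close> and \<open>t\<close> vanish too, and the point is the node.\<close>

lemma curve_parametrization:
  assumes "p \<in> curve"
  obtains u v where "u \<noteq> 0 \<or> v \<noteq> 0" "p = proj_pt (\<phi> u v)"
proof -
  obtain x y s t where p: "p = proj_pt (comb x y s t)" and nz: "comb x y s t \<noteq> 0"
    and eqs: "y\<^sup>2 = s * t" "2 * x * y = t\<^sup>2 - s\<^sup>2"
    using assms unfolding curve_def by blast
  show ?thesis
  proof (cases "y = 0")
    case True
    then have st: "s = 0" "t = 0" using eqs by auto
    then have x: "x \<noteq> 0" using nz True by (simp add: comb_eq_0_iff)
    have "comb x y s t = (- 2 * x) *\<^sub>R \<phi> 1 0"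
      unfolding \<phi>_def comb_scale comb_eq_iff using True st by simp
    then show ?thesis using that[of 1 0] x p proj_pt_scale[of "-2 * x"] by simp
  next
    case False
    then have s: "s \<noteq> 0" using eqs by auto
    have "\<phi> s y = (s\<^sup>2 * y) *\<^sub>R comb x y s t"
      unfolding \<phi>_def comb_scale comb_eq_iff
    proof (intro conjI)
      \<comment> \<open>Here \<open>y^4 = s\<^sup>2 * t\<^sup>2\<close>, so the second equation of
        the curve turns the first coordinate into the required multiple of \<open>x\<close>.\<close>
      have "y^4 = (y\<^sup>2)\<^sup>2" by simp
      then have "y^4 - s^4 = s\<^sup>2 * (t\<^sup>2 - s\<^sup>2)"
        unfolding eqs(1) by (simp add: algebra_simps power_numeral_reduce)
      then show "(y^4 - s^4) / 2 = s\<^sup>2 * y * x" unfolding eqs(2)[symmetric] by simp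
      have "s * y^3 = s * y * y\<^sup>2" by (simp add: power_numeral_reduce)
      then show "s * y^3 = s\<^sup>2 * y * t" unfolding eqs(1) by (simp only: ac_simps power2_eq_square)
    qed (simp_all add: power_numeral_reduce)
    then show ?thesis using that[of s y] s False p by (simp add: proj_pt_scale)
  qed
qed

text \<open>The parameter pair is packed into one complex number, so that the parameter space is the
  punctured plane, which is known to be connected.\<close>

lemma curve_eq: "curve = (\<lambda>\<zeta>. proj_pt (\<phi> (Re \<zeta>) (Im \<zeta>))) ` (- {0})"
proof (intro equalityI subsetI)
  fix p assume "p \<in> curve"
  then obtain u v where "u \<noteq> 0 \<or> v \<noteq> 0" "p = proj_pt (\<phi> u v)" by (rule curve_parametrization)
  then show "p \<in> (\<lambda>\<zeta>. proj_pt (\<phi> (Re \<zeta>) (Im \<zeta>))) ` (- {0})"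
    by (intro image_eqI[of _ _ "Complex u v"]) (auto simp: complex_eq_iff)
qed (auto intro!: \<phi>_in_curve simp: complex_eq_iff)

lemma connected_curve: "connected curve"
  unfolding curve_eq
proof (rule connected_continuous_image)
  show "connected (- {0::complex})"
    by (rule connected_punctured_universe) simp
  show "continuous_on (- {0}) (\<lambda>\<zeta>. proj_pt (\<phi> (Re \<zeta>) (Im \<zeta>)))"
    by (intro continuous_on_proj_pt continuous_on_\<phi> continuous_intros) (simp add: \<phi>_eq_0_iff complex_eq_iff)
qed

lemma open_component_curve: "open_component curve"
  unfolding open_component_def
proof (intro allI impI)
  fix n :: vec4
  define h where "h \<zeta> = n \<bullet> \<phi> (Re \<zeta>) (Im \<zeta>)" for \<zeta>
  have "connected (h ` (- {0}))"
    unfolding h_def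
    by (intro connected_continuous_image connected_punctured_universe continuous_intros continuous_on_\<phi>) simp
  moreover have "h 1 = - h \<i>"
    \<comment> \<open>The numbers \<open>1\<close> and \<open>\<i>\<close> are the two parameters of
      the node, which \<phi> sends to opposite multiples of \<open>e1\<close>.\<close>
    by (simp add: h_def \<phi>_def comb_def)
  \<comment> \<open>It is unknown which of the two values is the nonpositive one; \<open>min\<close>
    and \<open>max\<close> avoid a case split.\<close>
  then have "min (h 1) (h \<i>) \<le> 0" "0 \<le> max (h 1) (h \<i>)" by auto
  moreover have "h 1 \<in> h ` (- {0})" "h \<i> \<in> h ` (- {0})" by (auto intro!: imageI)
  then have "min (h 1) (h \<i>) \<in> h ` (- {0})" "max (h 1) (h \<i>) \<in> h ` (- {0})"
    by (auto simp: min_def max_def)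
  ultimately have "0 \<in> h ` (- {0})"
    using connectedD_interval by blast
  then obtain \<zeta> where "\<zeta> \<noteq> 0" "h \<zeta> = 0" by force
  then show "\<exists>X. X \<noteq> 0 \<and> n \<bullet> X = 0 \<and> proj_pt X \<in> curve"
    by (intro exI[of _ "\<phi> (Re \<zeta>) (Im \<zeta>)"]) (auto simp: h_def \<phi>_eq_0_iff complex_eq_iff intro!: \<phi>_in_curve)
qed

section \<open>The node and its two branches\<close>

lemma e1_nz: "e1 \<noteq> 0"
  using comb_eq_0_iff[of 1 0 0 0] by (simp add: comb_def)

lemma \<phi>_1_0: "\<phi> 1 0 = - (1/2) *\<^sub>R e1" and \<phi>_0_1: "\<phi> 0 1 = (1/2) *\<^sub>R e1"
  by (simp_all add: \<phi>_def comb_def)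

lemma proj_pt_\<phi>_node: "proj_pt (\<phi> 1 0) = proj_pt e1" "proj_pt (\<phi> 0 1) = proj_pt e1"
  unfolding \<phi>_1_0 \<phi>_0_1 by (simp_all add: proj_pt_scale del: scaleR_minus_left)

lemma proj_pt_\<phi>_eqD:
  assumes "proj_pt (\<phi> u v) = proj_pt (\<phi> u' v')" "u \<noteq> 0 \<or> v \<noteq> 0"
  obtains k where "k \<noteq> 0" "v^4 - u^4 = k * (v'^4 - u'^4)" "u\<^sup>2 * v\<^sup>2 = k * (u'\<^sup>2 * v'\<^sup>2)"
    "u^3 * v = k * (u'^3 * v')" "u * v^3 = k * (u' * v'^3)"
proof -
  obtain k where "\<phi> u v = k *\<^sub>R \<phi> u' v'" "k \<noteq> 0"
    using proj_pt_eqD[OF assms(1)] assms(2) by (auto simp: \<phi>_eq_0_iff)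
  then show ?thesis using that[of k] by (simp add: \<phi>_def comb_scale comb_eq_iff)
qed

text \<open>For \<open>u = 1\<close> the coordinates \<open>y\<close> and \<open>s\<close> are
  \<open>v\<^sup>2\<close> and \<open>v\<close>, so their ratio recovers \<open>v\<close> unless it
  is 0.\<close>

lemma branch_1_inj:
  assumes "proj_pt (\<phi> 1 v) = proj_pt (\<phi> 1 v')"
  shows "v = v'"
proof -
  obtain k where k: "k \<noteq> 0" "v\<^sup>2 = k * v'\<^sup>2" "v = k * v'"
    using proj_pt_\<phi>_eqD[OF assms] by auto
  then have "v * (v - v') = 0" by (simp add: power2_eq_square algebra_simps)
  then show ?thesis using k by auto
qed

lemma branch_2_inj:
  assumes "proj_pt (\<phi> u 1) = proj_pt (\<phi> u' 1)"
  shows "u = u'"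
proof -
  obtain k where k: "k \<noteq> 0" "u\<^sup>2 = k * u'\<^sup>2" "u = k * u'"
    using proj_pt_\<phi>_eqD[OF assms] by auto
  then have "u * (u - u') = 0" by (simp add: power2_eq_square algebra_simps)
  then show ?thesis using k by auto
qed

text \<open>For small parameters the \<open>x\<close>-coordinates have opposite signs, so the factor
  \<open>k\<close> is negative, whereas the \<open>y\<close>-coordinates are squares. The bounds
  matter: parameters with \<open>u * v = 1\<close> give the same point.\<close>

lemma branches_meet:
  assumes "proj_pt (\<phi> 1 v) = proj_pt (\<phi> u 1)" "\<bar>u\<bar> \<le> 1/2" "\<bar>v\<bar> \<le> 1/2"
  shows "u = 0 \<and> v = 0"
proof -
  obtain k where k: "v^4 - 1 = k * (1 - u^4)" "v\<^sup>2 = k * u\<^sup>2"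
    using proj_pt_\<phi>_eqD[OF assms(1)] by auto
  have small: "x^4 < 1" if "\<bar>x\<bar> \<le> 1/2" for x :: real
    using that power_less_one_iff[of "\<bar>x\<bar>" 4] by simp
  have "k < 0"
    using k(1) small[OF assms(2)] small[OF assms(3)] by (smt (verit) mult_nonneg_nonneg)
  have "k * u\<^sup>2 \<ge> 0" using k(2) zero_le_power2[of v] by linarith
  then have "u\<^sup>2 = 0" using \<open>k < 0\<close> by (smt (verit) mult_neg_pos zero_le_power2)
  then show ?thesis using k(2) by simp
qed

text \<open>The branches are the charts \<open>u = 1\<close> and \<open>v = 1\<close> of the
  parameter line, shifted so that the node sits at time 1/2. The neighbourhood is the complement of
  a compact piece \<open>K\<close> of the curve.\<close>

lemma crunode_if_qsic_eq_curve:
  assumes qsic: "qsic A B = curve" and dp: "double_point A B e1"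
  shows "crunode A B e1"
proof -
  define g1 where "g1 \<tau> = proj_pt (\<phi> 1 (\<tau> - 1/2))" for \<tau>
  define g2 where "g2 \<tau> = proj_pt (\<phi> (\<tau> - 1/2) 1)" for \<tau>
  \<comment> \<open>At the node the charts have the linear terms \<open>e3\<close> and
    \<open>e4\<close>; these are the two tangent directions.\<close>
  define d1 where "d1 = proj_pt_deriv (\<phi> 1 0) e3"
  define d2 where "d2 = proj_pt_deriv (\<phi> 0 1) e4"
  \<comment> \<open>\<open>K\<close> contains every point of the curve that lies on neither arc:
    there the ratio \<open>v / u\<close> has absolute value between 1/2 and 2. It misses the node,
    which is the value at \<open>v = 0\<close>.\<close>
  define K where "K = (\<lambda>v. proj_pt (\<phi> 1 v)) ` ({-2..-1/2} \<union> {1/2..2})"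
  have "compact K"
    unfolding K_def
    by (intro compact_continuous_image compact_Un continuous_on_proj_pt continuous_on_\<phi> continuous_intros compact_Icc)
      (simp add: \<phi>_eq_0_iff)
  then have "open (- K)" by (simp add: compact_imp_closed open_Compl)
  moreover have "proj_pt e1 \<in> - K"
    using branch_1_inj[of 0] by (force simp: K_def proj_pt_\<phi>_node(1)[symmetric])
  moreover have arc: "arc g1" "arc g2"
  proof -
    have "path g1" "path g2"
      unfolding path_def g1_def g2_def
      by (intro continuous_on_proj_pt continuous_on_\<phi> continuous_intros; simp add: \<phi>_eq_0_iff)+
    moreover have "inj_on g1 {0..1}" "inj_on g2 {0..1}"
      unfolding g1_def g2_def by (auto intro!: inj_onI dest: branch_1_inj branch_2_inj)
    ultimately show "arc g1" "arc g2" by (auto simp: arc_def)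
  qed
  moreover have sub: "path_image g1 \<subseteq> qsic A B" "path_image g2 \<subseteq> qsic A B"
    unfolding qsic path_image_def g1_def g2_def by (auto intro!: \<phi>_in_curve)
  moreover have node: "g1 (1/2) = proj_pt e1" "g2 (1/2) = proj_pt e1"
    by (simp_all add: g1_def g2_def proj_pt_\<phi>_node)
  moreover have "path_image g1 \<inter> path_image g2 = {proj_pt e1}"
  proof
    have "proj_pt e1 \<in> path_image g1" "proj_pt e1 \<in> path_image g2"
      unfolding path_image_def using node by (auto intro!: image_eqI[of _ _ "1/2"])
    then show "{proj_pt e1} \<subseteq> path_image g1 \<inter> path_image g2" by blast
    show "path_image g1 \<inter> path_image g2 \<subseteq> {proj_pt e1}"
    proof
      fix x assume "x \<in> path_image g1 \<inter> path_image g2"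
      then obtain a b where ab: "a \<in> {0..1}" "b \<in> {0..1}" "x = g1 a" "x = g2 b"
        unfolding path_image_def by blast
      have "proj_pt (\<phi> 1 (a - 1/2)) = proj_pt (\<phi> (b - 1/2) 1)"
        using ab(3,4) unfolding g1_def g2_def by (rule subst)
      moreover have "\<bar>a - 1/2\<bar> \<le> 1/2" "\<bar>b - 1/2\<bar> \<le> 1/2"
        using ab(1,2) unfolding abs_le_iff atLeastAtMost_iff by linarith+
      ultimately have "b - 1/2 = 0" using branches_meet by blast
      then have "b = 1/2" by linarith
      then show "x \<in> {proj_pt e1}" using ab(4) node(2) by blast
    qed
  qed
  moreover have "(g1 has_vector_derivative d1) (at (1/2))"
  proof -
    have "((\<lambda>\<tau>. \<phi> 1 (\<tau> - 1/2)) has_vector_derivative e3) (at (1/2))"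
      unfolding \<phi>_def comb_def by (auto intro!: derivative_eq_intros)
    from has_vector_derivative_proj_pt[OF this] show ?thesis
      by (simp add: g1_def[abs_def] d1_def \<phi>_eq_0_iff)
  qed
  moreover have "(g2 has_vector_derivative d2) (at (1/2))"
  proof -
    have "((\<lambda>\<tau>. \<phi> (\<tau> - 1/2) 1) has_vector_derivative e4) (at (1/2))"
      unfolding \<phi>_def comb_def by (auto intro!: derivative_eq_intros)
    from has_vector_derivative_proj_pt[OF this] show ?thesis
      by (simp add: g2_def[abs_def] d2_def \<phi>_eq_0_iff)
  qed
  moreover have tangents: "a = 0 \<and> b = 0" if "a *\<^sub>R d1 + b *\<^sub>R d2 = 0" for a b
  proof -
    \<comment> \<open>The two differentials are taken at opposite representatives of the node; a
      sign change moves them to one. A vanishing combination is then radial, that is, a combination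
      of \<open>e3\<close> and \<open>e4\<close> that is a multiple of \<open>e1\<close>.\<close>
    have "\<phi> 1 0 = - \<phi> 0 1" by (simp add: \<phi>_1_0 \<phi>_0_1)
    then have "proj_pt_deriv (\<phi> 0 1) ((- a) *\<^sub>R e3 + b *\<^sub>R e4) = 0"
      unfolding proj_pt_deriv_linear[symmetric]
      using that by (simp add: d1_def d2_def proj_pt_deriv_uminus)
    then obtain k where "(- a) *\<^sub>R e3 + b *\<^sub>R e4 = k *\<^sub>R \<phi> 0 1"
      using proj_pt_deriv_eq_0 \<phi>_eq_0_iff[of 0 1] by (metis zero_neq_one)
    moreover have "comb (- k / 2) 0 (- a) b = ((- a) *\<^sub>R e3 + b *\<^sub>R e4) - k *\<^sub>R \<phi> 0 1"
      by (simp add: \<phi>_0_1 comb_def algebra_simps)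
    ultimately have "comb (- k / 2) 0 (- a) b = 0" by simp
    then show ?thesis by (simp add: comb_eq_0_iff)
  qed
  moreover have "d1 \<noteq> d2" using tangents[of 1 "-1"] by auto
  moreover have "independent {d1, d2}"
  proof -
    have "d1 \<notin> span {d2}"
    proof
      assume "d1 \<in> span {d2}"
      then obtain k where "d1 - k *\<^sub>R d2 = 0" by (auto simp: span_breakdown_eq)
      then show False using tangents[of 1 "-k"] by simp
    qed
    moreover have "d2 \<noteq> 0" using tangents[of 0 1] by auto
    ultimately show ?thesis by (simp add: independent_insert dependent_single)
  qed
  moreover have "qsic A B \<inter> - K = (path_image g1 \<union> path_image g2) \<inter> - K"
  proof
    show "(path_image g1 \<union> path_image g2) \<inter> - K \<subseteq> qsic A B \<inter> - K" using sub by blast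
    show "qsic A B \<inter> - K \<subseteq> (path_image g1 \<union> path_image g2) \<inter> - K"
    proof
      fix x assume x: "x \<in> qsic A B \<inter> - K"
      then obtain u v where uv: "u \<noteq> 0 \<or> v \<noteq> 0" and xe: "x = proj_pt (\<phi> u v)"
        unfolding qsic by (blast elim: curve_parametrization)
      have x1: "x = proj_pt (\<phi> 1 (v / u))" if "u \<noteq> 0"
        using proj_pt_\<phi>_scale[of u 1 "v / u"] that by (simp add: xe)
      have x2: "x = proj_pt (\<phi> (u / v) 1)" if "v \<noteq> 0"
        using proj_pt_\<phi>_scale[of v "u / v" 1] that by (simp add: xe)
      consider "\<bar>v\<bar> \<le> \<bar>u\<bar> / 2" | "\<bar>u\<bar> \<le> \<bar>v\<bar> / 2" | "\<bar>u\<bar> / 2 < \<bar>v\<bar>" "\<bar>v\<bar> / 2 < \<bar>u\<bar>" by linarith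
      then have "x \<in> path_image g1 \<union> path_image g2"
      proof cases
        case 1
        then have u: "u \<noteq> 0" using uv by auto
        then have "\<bar>v / u\<bar> \<le> 1/2" using 1 by (simp add: divide_simps)
        then have "v / u + 1/2 \<in> {0..1}" unfolding atLeastAtMost_iff by linarith
        moreover have "x = g1 (v / u + 1/2)" using x1[OF u] by (simp add: g1_def)
        ultimately show ?thesis by (auto simp: path_image_def)
      next
        case 2
        then have v: "v \<noteq> 0" using uv by auto
        then have "\<bar>u / v\<bar> \<le> 1/2" using 2 by (simp add: divide_simps)
        then have "u / v + 1/2 \<in> {0..1}" unfolding atLeastAtMost_iff by linarith
        moreover have "x = g2 (u / v + 1/2)" using x2[OF v] by (simp add: g2_def)
        ultimately show ?thesis by (auto simp: path_image_def)
      next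
        case 3
        then have u: "u \<noteq> 0" by auto
        have "1/2 \<le> \<bar>v / u\<bar>" "\<bar>v / u\<bar> \<le> 2" using 3 u by (simp_all add: divide_simps)
        then have "v / u \<in> {-2..-1/2} \<union> {1/2..2}"
          unfolding Un_iff atLeastAtMost_iff by linarith
        then have "x \<in> K" unfolding K_def x1[OF u] by (rule imageI)
        then show ?thesis using x by blast
      qed
      then show "x \<in> (path_image g1 \<union> path_image g2) \<inter> - K" using x by blast
    qed
  qed
  ultimately show ?thesis
    unfolding crunode_def using dp by blast
qed

end

section \<open>Normal form of the pencil\<close>

lemma complex_poly_eq_if_eq_on_reals:
  fixes P Q :: "complex poly"
  assumes "\<And>l::real. poly P (of_real l) = poly Q (of_real l)"
  shows "P = Q"
proof (rule ccontr)
  assume "P \<noteq> Q"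
  then have "finite {x. poly (P - Q) x = 0}" by (intro poly_roots_finite) simp
  moreover have "range complex_of_real \<subseteq> {x. poly (P - Q) x = 0}" using assms by auto
  moreover have "infinite (range complex_of_real)"
    by (simp add: finite_image_iff inj_of_real infinite_UNIV_char_0)
  ultimately show False using finite_subset by blast
qed

text \<open>The factorisation known for real parameters is an identity of polynomials, so it makes
  \<open>z A - B\<close> singular over the complex numbers. The vectors \<open>p\<close> and
  \<open>q\<close> are the real and imaginary parts of a kernel vector.\<close>

lemma nonreal_eigenvector:
  fixes A B :: "real^'n^'n" and z :: complex and R :: "complex poly"
  assumes R: "\<And>l::real. complex_of_real (det (l *\<^sub>R A - B)) = poly R (of_real l)"
    and z: "poly R z = 0"
  obtains p q where "p \<noteq> 0 \<or> q \<noteq> 0"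
    "B *v p = Re z *\<^sub>R (A *v p) - Im z *\<^sub>R (A *v q)"
    "B *v q = Im z *\<^sub>R (A *v p) + Re z *\<^sub>R (A *v q)"
proof -
  let ?C = "\<chi> i j. z * complex_of_real (A $ i $ j) - complex_of_real (B $ i $ j)"
  let ?P = "det (\<chi> i j. [:- complex_of_real (B $ i $ j), complex_of_real (A $ i $ j):])"
  have "poly ?P (of_real l) = poly R (of_real l)" for l
    unfolding R[symmetric] poly_det by (simp add: det_def algebra_simps)
  then have "?P = R" by (rule complex_poly_eq_if_eq_on_reals)
  then have "det ?C = 0"
    using z poly_det[of "\<chi> i j. [:- complex_of_real (B $ i $ j), complex_of_real (A $ i $ j):]" z]
    by (simp add: algebra_simps)
  then obtain v where v: "?C *v v = 0" "v \<noteq> 0" using det_nz_iff_ker by blast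
  define p where "p = (\<chi> i. Re (v $ i))"
  define q where "q = (\<chi> i. Im (v $ i))"
  have pq: "p \<noteq> 0 \<or> q \<noteq> 0"
    using v(2) by (auto simp: vec_eq_iff p_def q_def complex_eq_iff)
  have row: "(\<Sum>j\<in>UNIV. (z * complex_of_real (A $ i $ j) - complex_of_real (B $ i $ j)) * v $ j) = 0" for i
    using v(1) by (simp add: vec_eq_iff matrix_vector_mult_def)
  have "(B *v p) $ i = Re z * (A *v p) $ i - Im z * (A *v q) $ i" for i
    using row[of i] unfolding complex_eq_iff
    by (simp add: matrix_vector_mult_def p_def q_def sum_distrib_left sum_subtractf algebra_simps)
  moreover have "(B *v q) $ i = Im z * (A *v p) $ i + Re z * (A *v q) $ i" for i
    using row[of i] unfolding complex_eq_iff
    by (simp add: matrix_vector_mult_def p_def q_def sum_distrib_left sum_subtractf sum.distrib algebra_simps)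
  ultimately show ?thesis
    using that[OF pq] by (simp add: vec_eq_iff)
qed

text \<open>The hypotheses say that the non-real number \<open>w1 + i w2\<close> times
  \<open>x + i y\<close> is zero; multiplying by the conjugate gives the conclusion.\<close>

lemma linear_system_nz:
  fixes x y :: "'a::real_vector"
  assumes "w1 *\<^sub>R x - w2 *\<^sub>R y = 0" "w2 *\<^sub>R x + w1 *\<^sub>R y = 0" "w2 \<noteq> (0::real)"
  shows "x = 0" "y = 0"
proof -
  have nz: "w1 * w1 + w2 * w2 \<noteq> 0"
    using assms(3) by (simp add: sum_squares_eq_zero_iff)
  have "w1 *\<^sub>R (w1 *\<^sub>R x - w2 *\<^sub>R y) + w2 *\<^sub>R (w2 *\<^sub>R x + w1 *\<^sub>R y) = (w1 * w1 + w2 * w2) *\<^sub>R x"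
    by (simp add: algebra_simps)
  then have "(w1 * w1 + w2 * w2) *\<^sub>R x = 0" by (simp only: assms(1,2) scaleR_zero_right add_0)
  then show "x = 0" using nz unfolding scaleR_eq_0_iff by blast
  then show "y = 0" using assms by simp
qed

text \<open>\<open>N\<close> is the singular member of the pencil, and \<open>p + i q\<close> is an
  eigenvector of the inverse of \<open>A\<close> times \<open>N\<close> for
  \<open>w1 + i w2\<close>. The double root appears as a kernel of dimension one together with the
  absence of any other real eigenvalue.\<close>

locale pencil_211 =
  fixes A N :: mat4 and X p q :: vec4 and w1 w2 :: real
  assumes symA: "transpose A = A" and symN: "transpose N = N"
    and A_ker: "A *v v = 0 \<Longrightarrow> v = 0"
    and X: "N *v X = 0" "X \<noteq> 0"
    and N_ker: "N *v v = 0 \<Longrightarrow> \<exists>k. v = k *\<^sub>R X"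
    and real_eigenvalue: "N *v v = l *\<^sub>R (A *v v) \<Longrightarrow> v \<noteq> 0 \<Longrightarrow> l = 0"
    and Np: "N *v p = w1 *\<^sub>R (A *v p) - w2 *\<^sub>R (A *v q)"
    and Nq: "N *v q = w2 *\<^sub>R (A *v p) + w1 *\<^sub>R (A *v q)"
    and w2: "w2 \<noteq> 0" and pq_nz: "p \<noteq> 0 \<or> q \<noteq> 0"
begin

lemmas lin = matrix_vector_right_distrib matrix_vector_mult_diff_distrib matrix_vector_mult_scaleR

lemmas A_comm = symmetric_dot[OF symA] and N_comm = symmetric_dot[OF symN]

lemma N_comb:
  "N *v (s *\<^sub>R p + t *\<^sub>R q) = A *v ((s * w1 + t * w2) *\<^sub>R p + (t * w1 - s * w2) *\<^sub>R q)"
  by (simp add: lin Np Nq algebra_simps)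

text \<open>Applying \<open>N\<close> and cancelling \<open>A\<close> gives the further relation
  \<open>t p - s q = 0\<close>. Together the two relations say that \<open>t + i s\<close>
  annihilates \<open>p + i q\<close>.\<close>

lemma pq_indep:
  assumes "s *\<^sub>R p + t *\<^sub>R q = 0"
  shows "s = 0 \<and> t = 0"
proof -
  have "(s * w1 + t * w2) *\<^sub>R p + (t * w1 - s * w2) *\<^sub>R q = 0"
    by (rule A_ker) (simp only: N_comb[symmetric] assms matrix_vector_mult_0_right)
  moreover have "(s * w1 + t * w2) *\<^sub>R p + (t * w1 - s * w2) *\<^sub>R q
      = w1 *\<^sub>R (s *\<^sub>R p + t *\<^sub>R q) + w2 *\<^sub>R (t *\<^sub>R p - s *\<^sub>R q)"
    by (simp add: algebra_simps)
  ultimately have "t *\<^sub>R p - s *\<^sub>R q = 0" using assms w2 by simp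
  then have "s = 0"
    using linear_system_nz[of t p s q] assms pq_nz by blast
  then show ?thesis
    using assms \<open>t *\<^sub>R p - s *\<^sub>R q = 0\<close> pq_nz by auto
qed

lemma N_comb_eq_0D:
  assumes "N *v (s *\<^sub>R p + t *\<^sub>R q) = 0"
  shows "s = 0 \<and> t = 0"
proof -
  have "(s * w1 + t * w2) *\<^sub>R p + (t * w1 - s * w2) *\<^sub>R q = 0"
    by (rule A_ker) (simp only: N_comb[symmetric] assms)
  from pq_indep[OF this] show ?thesis
    using linear_system_nz[of w1 t w2 s] w2 by (auto simp: algebra_simps)
qed

lemma Xpq_indep:
  assumes "k *\<^sub>R X + (s *\<^sub>R p + t *\<^sub>R q) = 0"
  shows "k = 0 \<and> s = 0 \<and> t = 0"
proof -
  have "N *v (k *\<^sub>R X + (s *\<^sub>R p + t *\<^sub>R q)) = N *v (s *\<^sub>R p + t *\<^sub>R q)"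
    using X by (simp add: lin)
  then show ?thesis using N_comb_eq_0D[of s t] assms X by simp
qed

text \<open>By symmetry the products of \<open>v\<close> with \<open>N p\<close> and
  \<open>N q\<close> arise from those with \<open>A p\<close> and \<open>A q\<close> through
  multiplication by \<open>w1 + i w2\<close>, which is invertible.\<close>

lemma A_orth_pq:
  assumes "p \<bullet> (N *v v) = 0" "q \<bullet> (N *v v) = 0"
  shows "p \<bullet> (A *v v) = 0" "q \<bullet> (A *v v) = 0"
proof -
  have "w1 *\<^sub>R (v \<bullet> (A *v p)) - w2 *\<^sub>R (v \<bullet> (A *v q)) = 0"
    "w2 *\<^sub>R (v \<bullet> (A *v p)) + w1 *\<^sub>R (v \<bullet> (A *v q)) = 0"
    using assms N_comm[of p v] N_comm[of q v] by (simp_all add: Np Nq inner_diff_right inner_add_right)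
  from linear_system_nz[OF this w2] show "p \<bullet> (A *v v) = 0" "q \<bullet> (A *v v) = 0"
    using A_comm by auto
qed

lemma AXp: "p \<bullet> (A *v X) = 0" "q \<bullet> (A *v X) = 0"
  using A_orth_pq[of X] X by auto

section \<open>The null vector \<open>X\<close> and its Jordan chain\<close>

lemma independent_Xpq: "independent {X, p, q}" and card_Xpq: "card {X, p, q} = 3"
proof -
  have pq: "p \<noteq> q" "q \<noteq> 0"
    using pq_indep[of 1 "-1"] pq_indep[of 0 1] by auto
  have X_span: "X \<notin> span {p, q}"
  proof
    assume "X \<in> span {p, q}"
    then obtain s t where "X - s *\<^sub>R p - t *\<^sub>R q = 0"
      by (auto simp: span_breakdown_eq)
    then show False using Xpq_indep[of 1 "-s" "-t"] by (simp add: algebra_simps)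
  qed
  have p_span: "p \<notin> span {q}"
  proof
    assume "p \<in> span {q}"
    then obtain t where "p - t *\<^sub>R q = 0" by (auto simp: span_breakdown_eq)
    then show False using pq_indep[of 1 "-t"] by simp
  qed
  show "independent {X, p, q}"
    using X_span p_span pq by (simp add: independent_insert dependent_single)
  show "card {X, p, q} = 3"
    using X_span pq by (subst card_insert_disjoint) (auto intro: span_base)
qed

text \<open>The \<open>A\<close>-orthogonal complement of \<open>X, p, q\<close> is a line invariant
  under the inverse of \<open>A\<close> times \<open>N\<close>. Its generator \<open>Y\<close> is
  thus a real eigenvector, hence a multiple of \<open>X\<close>, and its orthogonality to
  \<open>X\<close> becomes the claim.\<close>

lemma AXX: "X \<bullet> (A *v X) = 0"
proof -
  define H where "H = {v \<in> UNIV. \<forall>x\<in>span {X, p, q}. orthogonal x v}"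
  have "dim H + dim (span {X, p, q}) = DIM(vec4)"
    unfolding H_def by (subst dim_subspace_orthogonal_to_vectors) auto
  moreover have "dim (span {X, p, q}) = 3"
    using dim_eq_card_independent[OF independent_Xpq] card_Xpq by simp
  ultimately have dimH: "dim H = 1" by simp
  have H_iff: "v \<in> H \<longleftrightarrow> X \<bullet> v = 0 \<and> p \<bullet> v = 0 \<and> q \<bullet> v = 0" for v
  proof
    assume "v \<in> H"
    then show "X \<bullet> v = 0 \<and> p \<bullet> v = 0 \<and> q \<bullet> v = 0"
      unfolding H_def orthogonal_def by (auto intro: span_base)
  next
    assume v: "X \<bullet> v = 0 \<and> p \<bullet> v = 0 \<and> q \<bullet> v = 0"
    show "v \<in> H"
      unfolding H_def
    proof (intro CollectI conjI ballI UNIV_I)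
      fix x assume "x \<in> span {X, p, q}"
      then have "orthogonal v x"
        by (rule orthogonal_to_span) (use v in \<open>auto simp: orthogonal_def inner_commute\<close>)
      then show "orthogonal x v" by (simp add: orthogonal_commute)
    qed
  qed
  obtain h where h: "h \<in> H" "h \<noteq> 0"
    using dimH by (metis dim_eq_0 One_nat_def zero_neq_one subset_iff singletonI)
  have "surj ((*v) A)"
    using A_ker by (intro linear_injective_imp_surjective) (auto simp: linear_injective_0)
  then obtain Y where Y: "h = A *v Y" by blast
  have Yh: "X \<bullet> (A *v Y) = 0" "p \<bullet> (A *v Y) = 0" "q \<bullet> (A *v Y) = 0"
    using h(1) by (simp_all add: H_iff Y)
  \<comment> \<open>\<open>N\<close> sends each of \<open>X, p, q\<close> to a combination of
    \<open>A p\<close> and \<open>A q\<close>, so orthogonality of \<open>A Y\<close> to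
    \<open>X, p, q\<close> passes to \<open>N Y\<close>.\<close>
  have "N *v Y \<in> H"
    unfolding H_iff using N_comm[of X Y] N_comm[of p Y] N_comm[of q Y] Yh A_comm[of p Y] A_comm[of q Y]
    by (simp add: X Np Nq inner_add_right inner_diff_right)
  moreover have "H = span {h}"
  proof -
    have "subspace H"
      by (auto simp: subspace_def H_iff inner_add_right)
    moreover from this have "span {h} \<subseteq> H" using h by (intro span_minimal) auto
    moreover have "dim (span {h}) = 1" using h by (simp add: dim_eq_card_independent[of "{h}"] dependent_single)
    ultimately show ?thesis using subspace_dim_equal[of "span {h}" H] dimH by simp
  qed
  ultimately obtain l where "N *v Y = l *\<^sub>R (A *v Y)"
    by (auto simp: Y span_breakdown_eq)
  moreover have "Y \<noteq> 0" using h Y by auto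
  ultimately have "N *v Y = 0" using real_eigenvalue[of Y l] by simp
  then obtain k where "Y = k *\<^sub>R X" using N_ker by blast
  then show ?thesis using Yh(1) \<open>Y \<noteq> 0\<close> by (simp add: lin)
qed

text \<open>The range of a symmetric matrix is the orthogonal complement of its kernel, here the
  line of \<open>X\<close>, and \<open>A X\<close> is orthogonal to \<open>X\<close> by
  \<open>AXX\<close>.\<close>

lemma generalized_eigenvector: obtains Y where "N *v Y = A *v X"
proof -
  obtain y v where yv: "y \<in> span (range ((*v) N))" "\<And>u. u \<in> span (range ((*v) N)) \<Longrightarrow> orthogonal v u"
      "A *v X = y + v"
    using orthogonal_subspace_decomp_exists[of "range ((*v) N)" "A *v X"] by blast
  have span: "span (range ((*v) N)) = range ((*v) N)"
    by (metis linear_span_image matrix_vector_mul_linear span_UNIV)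
  have "v \<bullet> (N *v u) = 0" for u
    using yv(2)[of "N *v u"] span by (simp add: orthogonal_def)
  then have "(N *v v) \<bullet> (N *v v) = 0" using N_comm[of v "N *v v"] by metis
  then obtain k where "v = k *\<^sub>R X" using N_ker[of v] by auto
  then have "v \<bullet> (A *v X) = 0" using AXX by simp
  moreover have "v \<bullet> y = 0" using yv(1,2) by (simp add: orthogonal_def)
  ultimately have "v = 0" by (simp add: yv(3) inner_add_right)
  then show ?thesis using yv(1,3) span that by auto
qed

text \<open>\<open>Y, X, p, q\<close> form a basis: were \<open>Y\<close> in the span of the others,
  then \<open>A X = N Y\<close> would be a combination of \<open>A p\<close> and \<open>A q\<close>,
  and cancelling \<open>A\<close> would contradict independence.\<close>

lemma orth_basis:
  assumes Y: "N *v Y = A *v X"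
    and v: "X \<bullet> v = 0" "Y \<bullet> v = 0" "p \<bullet> v = 0" "q \<bullet> v = 0"
  shows "v = 0"
proof -
  have Y_span: "Y \<notin> span {X, p, q}"
  proof
    assume "Y \<in> span {X, p, q}"
    then obtain k s t where "Y - k *\<^sub>R X - s *\<^sub>R p - t *\<^sub>R q = 0"
      by (auto simp: span_breakdown_eq)
    then have e: "Y = k *\<^sub>R X + (s *\<^sub>R p + t *\<^sub>R q)" by (simp add: algebra_simps)
    have "N *v Y = N *v (s *\<^sub>R p + t *\<^sub>R q)"
      unfolding e matrix_vector_right_distrib[of N "k *\<^sub>R X"] by (simp add: lin X)
    then have "A *v (X + ((-(s * w1 + t * w2)) *\<^sub>R p + (-(t * w1 - s * w2)) *\<^sub>R q)) = 0"
      unfolding Y N_comb by (simp add: lin algebra_simps)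
    from A_ker[OF this] show False
      using Xpq_indep[of 1 "-(s * w1 + t * w2)" "-(t * w1 - s * w2)"] by simp
  qed
  then have ind: "independent {Y, X, p, q}" 
    using independent_Xpq by (simp add: independent_insert)
  moreover have "card {Y, X, p, q} = 4"
    using Y_span card_Xpq span_base[of Y "{X, p, q}"] by (subst card_insert_disjoint) auto
  ultimately have "span {Y, X, p, q} = UNIV"
    using card_ge_dim_independent[of "{Y, X, p, q}" UNIV] by auto
  then have "orthogonal v v"
    using v by (intro orthogonal_to_span[of v "{Y, X, p, q}"]) (auto simp: orthogonal_def inner_commute)
  then show ?thesis by (simp add: orthogonal_self)
qed

text \<open>The last two relations express that \<open>p + i q\<close> and \<open>p - i q\<close>,
  having different eigenvalues, are orthogonal for both forms.\<close>

lemma form_relations: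
  "p \<bullet> (N *v p) = w1 * (p \<bullet> (A *v p)) - w2 * (p \<bullet> (A *v q))"
  "p \<bullet> (N *v q) = w2 * (p \<bullet> (A *v p)) + w1 * (p \<bullet> (A *v q))"
  "q \<bullet> (A *v q) = - (p \<bullet> (A *v p))"
  "q \<bullet> (N *v q) = - (p \<bullet> (N *v p))"
proof -
  show pp: "p \<bullet> (N *v p) = w1 * (p \<bullet> (A *v p)) - w2 * (p \<bullet> (A *v q))"
    by (simp add: Np inner_diff_right)
  show pq: "p \<bullet> (N *v q) = w2 * (p \<bullet> (A *v p)) + w1 * (p \<bullet> (A *v q))"
    by (simp add: Nq inner_add_right)
  have "q \<bullet> (N *v p) = w1 * (p \<bullet> (A *v q)) - w2 * (q \<bullet> (A *v q))"
    by (simp add: Np inner_diff_right A_comm[of q p])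
  then have "w2 * (p \<bullet> (A *v p) + q \<bullet> (A *v q)) = 0"
    using pq N_comm[of p q] by (simp add: algebra_simps)
  then show qq: "q \<bullet> (A *v q) = - (p \<bullet> (A *v p))"
    using w2 by simp
  show "q \<bullet> (N *v q) = - (p \<bullet> (N *v p))"
    unfolding pp by (simp add: Nq inner_add_right A_comm[of q p] qq)
qed

lemma AXY_nz:
  assumes Y: "N *v Y = A *v X"
  shows "X \<bullet> (A *v Y) \<noteq> 0"
  using orth_basis[OF Y, of "A *v X"] AXX AXp A_ker[of X] X A_comm[of X Y] by auto

lemma AYp:
  assumes Y: "N *v Y = A *v X"
  shows "p \<bullet> (A *v Y) = 0" "q \<bullet> (A *v Y) = 0"
  using A_orth_pq[of Y] AXp by (auto simp: Y)

text \<open>Otherwise \<open>A p\<close> and \<open>A q\<close> would be orthogonal to the whole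
  basis \<open>X, Y, p, q\<close>, hence zero.\<close>

lemma N_pq_nz: "p \<bullet> (N *v p) \<noteq> 0 \<or> p \<bullet> (N *v q) \<noteq> 0"
proof (rule ccontr)
  assume "\<not> ?thesis"
  then have 0: "p \<bullet> (N *v p) = 0" "p \<bullet> (N *v q) = 0" by auto
  have A0: "p \<bullet> (A *v p) = 0" "p \<bullet> (A *v q) = 0"
    using linear_system_nz[of w1 "p \<bullet> (A *v p)" w2 "p \<bullet> (A *v q)"] 0 w2
    by (simp_all add: form_relations)
  obtain Y where Y: "N *v Y = A *v X" by (rule generalized_eigenvector)
  have "A *v p = 0"
    using orth_basis[OF Y, of "A *v p"] AXp AYp[OF Y] A0 A_comm[of p] by metis
  moreover have "A *v q = 0"
    using orth_basis[OF Y, of "A *v q"] AXp AYp[OF Y] A0 A_comm[of q] form_relations(3) by (metis neg_0_equal_iff_equal)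
  ultimately show False using A_ker pq_nz by blast
qed

text \<open>Multiplying \<open>p + i q\<close> by \<zeta> gives another eigenvector and multiplies
  the value of the \<open>N\<close>-form by the square of \<zeta>, so any nonzero value can be
  reached.\<close>

lemma rotate_pq:
  fixes c :: real
  assumes c: "c \<noteq> 0"
  obtains p' q' where "pencil_211 A N X p' q' w1 w2" "p' \<bullet> (N *v p') = 0" "p' \<bullet> (N *v q') = c"
proof -
  \<comment> \<open>Half the value of the complex bilinear form of \<open>N\<close> at
    \<open>p + i q\<close>; the target value is \<open>i c\<close>.\<close>
  define n where "n = Complex (p \<bullet> (N *v p)) (p \<bullet> (N *v q))"
  have n: "n \<noteq> 0" using N_pq_nz by (auto simp: n_def complex_eq_iff)
  define \<zeta> where "\<zeta> = csqrt (Complex 0 c / n)"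
  have \<zeta>n: "\<zeta>\<^sup>2 * n = Complex 0 c" using n by (simp add: \<zeta>_def)
  have \<zeta>: "\<zeta> \<noteq> 0" using \<zeta>n c by (auto simp: complex_eq_iff)
  define u where "u = Re \<zeta>"
  define v where "v = Im \<zeta>"
  have uv: "(u * u - v * v) * (p \<bullet> (N *v p)) - 2 * u * v * (p \<bullet> (N *v q)) = 0"
    "(u * u - v * v) * (p \<bullet> (N *v q)) + 2 * u * v * (p \<bullet> (N *v p)) = c"
    using \<zeta>n by (simp_all add: complex_eq_iff n_def u_def v_def power2_eq_square algebra_simps)
  define p' where "p' = u *\<^sub>R p - v *\<^sub>R q"
  define q' where "q' = v *\<^sub>R p + u *\<^sub>R q"
  have "p' \<noteq> 0"
    using pq_indep[of u "-v"] \<zeta> by (auto simp: p'_def u_def v_def complex_eq_iff)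
  then have "pencil_211 A N X p' q' w1 w2"
    using symA symN A_ker X N_ker real_eigenvalue w2
    by unfold_locales (auto simp: p'_def q'_def lin Np Nq algebra_simps)
  moreover have "p' \<bullet> (N *v p') = 0" "p' \<bullet> (N *v q') = c"
    using uv by (simp_all add: p'_def q'_def lin inner_add_left inner_add_right inner_diff_left inner_diff_right
        N_comm[of q p] form_relations(4) algebra_simps)
  ultimately show ?thesis by (rule that)
qed

lemma normal_form:
  obtains c \<rho> \<sigma> e1 e2 e3 e4 where "c \<noteq> 0" "\<rho> \<noteq> 0" "N *v e1 = 0" "frame4 e1 e2 e3 e4"
    "\<And>x y s t. frame4.comb e1 e2 e3 e4 x y s t \<bullet> (N *v frame4.comb e1 e2 e3 e4 x y s t)
       = c * (y\<^sup>2 - s * t)"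
    "\<And>x y s t. frame4.comb e1 e2 e3 e4 x y s t \<bullet> (A *v frame4.comb e1 e2 e3 e4 x y s t)
       = \<rho> * (2 * x * y + s\<^sup>2 - t\<^sup>2) + 2 * \<sigma> * (s * t - y\<^sup>2)"
proof -
  obtain Y where Y: "N *v Y = A *v X" by (rule generalized_eigenvector)
  define c where "c = X \<bullet> (A *v Y)"
  have c: "c \<noteq> 0" unfolding c_def using AXY_nz[OF Y] .
  \<comment> \<open>The value \<open>- c / 2\<close> makes the mixed term of \<open>N\<close> equal
    to \<open>- c * s * t\<close>, matching the term \<open>c * y\<^sup>2\<close> contributed by
    \<open>Y\<close>.\<close>
  obtain e3 e4 where loc: "pencil_211 A N X e3 e4 w1 w2"
    and N33: "e3 \<bullet> (N *v e3) = 0" and N34: "e3 \<bullet> (N *v e4) = - c / 2"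
    using rotate_pq[of "- c / 2"] c by auto
  interpret e: pencil_211 A N X e3 e4 w1 w2 by (rule loc)
  define \<rho> where "\<rho> = e3 \<bullet> (A *v e3)"
  define \<sigma> where "\<sigma> = e3 \<bullet> (A *v e4)"
  have \<rho>: "\<rho> \<noteq> 0"
  proof
    assume "\<rho> = 0"
    then show False
      using e.form_relations(1,2) N33 N34 w2 c by (simp flip: \<rho>_def \<sigma>_def)
  qed
  \<comment> \<open>Adding a multiple of \<open>X\<close> to \<open>Y\<close> leaves the
    \<open>N\<close>-form unchanged and shifts the \<open>A\<close>-form. With this \<open>k\<close>
    its value at \<open>e2\<close> is -2 \<sigma>, so the terms in \<sigma> combine to a multiple of
    the \<open>N\<close>-form. The scaling of \<open>e1\<close> turns the coefficient of
    \<open>2 * x * y\<close> into \<rho>.\<close>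
  define k where "k = - (2 * \<sigma> + Y \<bullet> (A *v Y)) / (2 * c)"
  define e1 where "e1 = (\<rho> / c) *\<^sub>R X"
  define e2 where "e2 = Y + k *\<^sub>R X"
  have A_gram: "e1 \<bullet> (A *v e1) = 0" "e1 \<bullet> (A *v e2) = \<rho>" "e2 \<bullet> (A *v e2) = - 2 * \<sigma>"
    "e3 \<bullet> (A *v e1) = 0" "e4 \<bullet> (A *v e1) = 0" "e3 \<bullet> (A *v e2) = 0" "e4 \<bullet> (A *v e2) = 0"
    "e3 \<bullet> (A *v e3) = \<rho>" "e3 \<bullet> (A *v e4) = \<sigma>" "e4 \<bullet> (A *v e4) = - \<rho>"
    using c e.AXX e.AXp e.AYp[OF Y] e.form_relations(3) A_comm[of Y X]
    by (simp_all add: e1_def e2_def lin inner_add_left inner_add_right c_def[symmetric] \<rho>_def[symmetric] \<sigma>_def[symmetric] k_def field_simps)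
  have N1: "N *v e1 = 0" by (simp add: e1_def lin X)
  have N_gram: "e2 \<bullet> (N *v e2) = c" "e3 \<bullet> (N *v e2) = 0" "e4 \<bullet> (N *v e2) = 0"
    "e4 \<bullet> (N *v e4) = 0"
    using e.AXX e.AXp e.form_relations(4) N33 A_comm[of Y X]
    by (simp_all add: e2_def lin X Y inner_add_left c_def[symmetric])
  note gram = A_gram N1 N_gram N33 N34
    A_gram(2)[unfolded A_comm[of e1]] A_gram(4)[unfolded A_comm[of e3]] A_gram(5)[unfolded A_comm[of e4]]
    A_gram(6)[unfolded A_comm[of e3]] A_gram(7)[unfolded A_comm[of e4]] A_gram(9)[unfolded A_comm[of e3]]
    N_gram(2)[unfolded N_comm[of e3]] N_gram(3)[unfolded N_comm[of e4]] N34[unfolded N_comm[of e3]]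
  have inj: "x = 0 \<and> y = 0 \<and> s = 0 \<and> t = 0"
    if "x *\<^sub>R e1 + y *\<^sub>R e2 + s *\<^sub>R e3 + t *\<^sub>R e4 = 0" (is "?V = 0") for x y s t
  proof -
    \<comment> \<open>Pairing through \<open>N\<close> isolates \<open>y\<close>, \<open>t\<close>
      and \<open>s\<close>; one pairing through \<open>A\<close> then isolates
      \<open>x\<close>.\<close>
    have "e2 \<bullet> (N *v ?V) = c * y" "e3 \<bullet> (N *v ?V) = - c / 2 * t" "e4 \<bullet> (N *v ?V) = - c / 2 * s"
      "e2 \<bullet> (A *v ?V) = \<rho> * x - 2 * \<sigma> * y"
      by (simp_all add: lin gram inner_add_right)
    then show ?thesis using c \<rho> unfolding that by simp
  qed
  define f where "f w = w $ 1 *\<^sub>R e1 + w $ 2 *\<^sub>R e2 + w $ 3 *\<^sub>R e3 + w $ 4 *\<^sub>R e4" for w :: vec4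
  have "linear f"
    by (rule linearI) (simp_all add: f_def algebra_simps)
  moreover have "inj f"
    unfolding linear_injective_0[OF \<open>linear f\<close>]
  proof (intro allI impI)
    fix w assume "f w = 0"
    then show "w = 0" using inj[OF \<open>f w = 0\<close>[unfolded f_def]] by (simp add: vec_eq_iff forall_4)
  qed
  ultimately have "surj f" by (intro linear_injective_imp_surjective) auto
  then have span: "\<exists>x y s t. V = x *\<^sub>R e1 + y *\<^sub>R e2 + s *\<^sub>R e3 + t *\<^sub>R e4" for V
    using surjD[of f V] unfolding f_def by blast
  interpret frame4 e1 e2 e3 e4
    by unfold_locales (rule span, rule inj)
  have form_N: "comb x y s t \<bullet> (N *v comb x y s t) = c * (y\<^sup>2 - s * t)" for x y s t
    by (simp add: comb_def lin gram inner_add_left inner_add_right N_comm[of e1] power2_eq_square algebra_simps)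
  have form_A: "comb x y s t \<bullet> (A *v comb x y s t)
      = \<rho> * (2 * x * y + s\<^sup>2 - t\<^sup>2) + 2 * \<sigma> * (s * t - y\<^sup>2)" for x y s t
    by (simp add: comb_def lin gram inner_add_left inner_add_right power2_eq_square algebra_simps)
  show ?thesis
    by (rule that[OF c \<rho> N1 frame4_axioms form_N form_A])
qed

end

section \<open>Index function and intersection curve in normal coordinates\<close>

context frame4
begin

text \<open>On \<open>y = 0\<close> the form of \<open>\<mu> A - N\<close> does not involve
  \<open>x\<close> and is the binary form \<open>a (s\<^sup>2 - t\<^sup>2) + b s t\<close>. Its
  discriminant is positive, so it vanishes on a real line \<open>t = \<tau> s\<close>, which
  together with \<open>e1\<close> spans a null plane.\<close>

lemma num_pos_eigenvalues_pencil:
  fixes A N :: mat4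
  assumes symA: "transpose A = A" and symN: "transpose N = N"
    and form_N: "\<And>x y s t. comb x y s t \<bullet> (N *v comb x y s t) = c * (y\<^sup>2 - s * t)"
    and form_A: "\<And>x y s t. comb x y s t \<bullet> (A *v comb x y s t)
      = \<rho> * (2 * x * y + s\<^sup>2 - t\<^sup>2) + 2 * \<sigma> * (s * t - y\<^sup>2)"
    and \<rho>: "\<rho> \<noteq> 0" and det: "det (\<mu> *\<^sub>R A - N) \<noteq> 0" and \<mu>: "\<mu> \<noteq> 0"
  shows "num_pos_eigenvalues (\<mu> *\<^sub>R A - N) = 2"
proof -
  define b where "b = 2 * \<mu> * \<sigma> + c"
  define a where "a = \<mu> * \<rho>"
  \<comment> \<open>A root of the binary form at \<open>s = 1\<close>.\<close>
  define \<tau> where "\<tau> = (b + sqrt (b\<^sup>2 + 4 * a\<^sup>2)) / (2 * a)"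
  have a: "a \<noteq> 0" using \<mu> \<rho> by (simp add: a_def)
  have "(2 * a * \<tau> - b)\<^sup>2 = b\<^sup>2 + 4 * a\<^sup>2"
    using a by (simp add: \<tau>_def)
  then have "4 * a * (a - a * \<tau>\<^sup>2 + b * \<tau>) = 0"
    by (simp add: power2_eq_square algebra_simps)
  then have \<tau>: "a - a * \<tau>\<^sup>2 + b * \<tau> = 0" using a by simp
  define Z where "Z = span {e1, e3 + \<tau> *\<^sub>R e4}"
  have "e1 \<notin> span {e3 + \<tau> *\<^sub>R e4}"
  proof
    assume "e1 \<in> span {e3 + \<tau> *\<^sub>R e4}"
    then obtain k where "e1 - k *\<^sub>R (e3 + \<tau> *\<^sub>R e4) = 0" by (auto simp: span_breakdown_eq)
    moreover have "comb 1 0 (- k) (- k * \<tau>) = e1 - k *\<^sub>R (e3 + \<tau> *\<^sub>R e4)"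
      by (simp add: comb_def algebra_simps)
    ultimately have "comb 1 0 (- k) (- k * \<tau>) = 0" by simp
    then show False by (simp add: comb_eq_0_iff)
  qed
  moreover have "e3 + \<tau> *\<^sub>R e4 \<noteq> 0"
    using comb_eq_0_iff[of 0 0 1 \<tau>] by (simp add: comb_def)
  ultimately have "independent {e1, e3 + \<tau> *\<^sub>R e4}" "e1 \<noteq> e3 + \<tau> *\<^sub>R e4"
    by (auto simp: independent_insert dependent_single span_base)
  then have dimZ: "dim Z = 2"
    unfolding Z_def by (simp add: dim_eq_card_independent)
  have null: "V \<bullet> ((\<mu> *\<^sub>R A - N) *v V) = 0" if "V \<in> Z" for V
  proof -
    obtain x s where "V - x *\<^sub>R e1 - s *\<^sub>R (e3 + \<tau> *\<^sub>R e4) = 0"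
      using \<open>V \<in> Z\<close> unfolding Z_def by (auto simp: span_breakdown_eq)
    then have "V = x *\<^sub>R e1 + s *\<^sub>R (e3 + \<tau> *\<^sub>R e4)"
      by (simp only: diff_diff_eq flip: eq_iff_diff_eq_0)
    also have "\<dots> = comb x 0 s (s * \<tau>)" by (simp add: comb_def algebra_simps)
    finally have V: "V = comb x 0 s (s * \<tau>)" .
    have "V \<bullet> ((\<mu> *\<^sub>R A - N) *v V) = \<mu> * (V \<bullet> (A *v V)) - V \<bullet> (N *v V)"
      by (simp add: matrix_vector_mult_diff_rdistrib inner_diff_right scaleR_matrix_vector_assoc[symmetric])
    also have "\<dots> = s\<^sup>2 * (a - a * \<tau>\<^sup>2 + b * \<tau>)"
      unfolding V form_A form_N by (simp add: a_def b_def power2_eq_square algebra_simps)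
    finally show ?thesis by (simp add: \<tau>)
  qed
  have "transpose (\<mu> *\<^sub>R A - N) = \<mu> *\<^sub>R A - N"
    using symA symN by (simp add: vec_eq_iff transpose_def)
  moreover have "subspace Z" by (simp add: Z_def)
  ultimately show ?thesis
    using num_pos_eigenvalues_half_null[of "\<mu> *\<^sub>R A - N" Z] det null dimZ by simp
qed

text \<open>On the zero set of the \<open>A\<close>-form, the \<open>B\<close>-form reduces to
  \<open>c (y\<^sup>2 - s t)\<close>; once this vanishes, the term in \<sigma> drops out of the
  \<open>A\<close>-form.\<close>

lemma qsic_eq_curve:
  assumes form_B: "\<And>x y s t. comb x y s t \<bullet> (B *v comb x y s t)
      = c * (y\<^sup>2 - s * t) + r * (comb x y s t \<bullet> (A *v comb x y s t))"
    and form_A: "\<And>x y s t. comb x y s t \<bullet> (A *v comb x y s t)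
      = \<rho> * (2 * x * y + s\<^sup>2 - t\<^sup>2) + 2 * \<sigma> * (s * t - y\<^sup>2)"
    and \<rho>: "\<rho> \<noteq> 0" and c: "c \<noteq> 0"
  shows "qsic A B = curve"
proof -
  have on: "on_quadric A (comb x y s t) \<and> on_quadric B (comb x y s t)
      \<longleftrightarrow> y\<^sup>2 = s * t \<and> 2 * x * y = t\<^sup>2 - s\<^sup>2" for x y s t
  proof -
    have "on_quadric A (comb x y s t) \<and> on_quadric B (comb x y s t)
        \<longleftrightarrow> comb x y s t \<bullet> (A *v comb x y s t) = 0 \<and> c * (y\<^sup>2 - s * t) = 0"
      by (auto simp: on_quadric_def form_B)
    also have "\<dots> \<longleftrightarrow> 2 * x * y + s\<^sup>2 - t\<^sup>2 = 0 \<and> y\<^sup>2 - s * t = 0"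
      using \<rho> c by (auto simp: form_A)
    finally show ?thesis by auto
  qed
  show ?thesis
  proof (intro equalityI subsetI)
    fix m assume "m \<in> qsic A B"
    then obtain V where V: "m = proj_pt V" "V \<noteq> 0" "on_quadric A V" "on_quadric B V"
      unfolding qsic_def by blast
    obtain x y s t where "V = comb x y s t"
      using e_span[of V] unfolding comb_def by blast
    then show "m \<in> curve" using V on[of x y s t] unfolding curve_def by blast
  next
    fix m assume "m \<in> curve"
    then show "m \<in> qsic A B" using on unfolding curve_def qsic_def by blast
  qed
qed

end

section \<open>Conclusion\<close>

theorem theorem8:
  fixes A B :: mat4 and r :: real and z :: complex
  assumes symA: "symmetric_mat A" and symB: "symmetric_mat B"
    and roots: "\<forall>l::real. complex_of_real (det (l *\<^sub>R A - B)) =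
                  complex_of_real (det A) * (of_real l - of_real r)^2 *
                  (of_real l - z) * (of_real l - cnj z)"
    and detA: "det A \<noteq> 0"
    and nonreal: "Im z \<noteq> 0"
    and segre: "num_jordan_blocks (matrix_inv A ** B) r = 1"
  shows "(\<forall>l<r. Id_pencil A B l = 2) \<and> (\<forall>l>r. Id_pencil A B l = 2) \<and>
         (\<exists>K. qsic_components A B = {K} \<and> open_component K \<and>
              (\<exists>X. proj_pt X \<in> K \<and> crunode A B X))"
proof -
  define N where "N = B - r *\<^sub>R A"
  have N_mult: "N *v v = B *v v - r *\<^sub>R (A *v v)" for v
    by (simp add: N_def matrix_vector_mult_diff_rdistrib scaleR_matrix_vector_assoc)
  have A_sym: "transpose A = A" and N_sym: "transpose N = N"
    using symA symB by (simp_all add: symmetric_mat_def N_def vec_eq_iff transpose_def)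
  have A_ker: "v = 0" if "A *v v = 0" for v
    using detA that unfolding det_nz_iff_ker by blast
  have det_nz: "det (l *\<^sub>R A - B) \<noteq> 0" if "l \<noteq> r" for l
  proof -
    have "complex_of_real l \<noteq> z" "complex_of_real l \<noteq> cnj z" "complex_of_real l \<noteq> of_real r"
      using nonreal that by (auto simp: complex_eq_iff)
    then have "complex_of_real (det (l *\<^sub>R A - B)) \<noteq> 0"
      using roots detA by simp
    then show ?thesis by simp
  qed

  \<comment> \<open>The Jordan blocks for \<open>r\<close> are counted by the kernel of
    \<open>N\<close>, so the Segre hypothesis says that this kernel is a line.\<close>
  have "{v. (matrix_inv A ** B) *v v = r *\<^sub>R v} = {v. N *v v = 0}"
  proof -
    have "invertible A" using detA by (simp add: invertible_det_nz)
    then have inv: "A ** matrix_inv A = mat 1" "matrix_inv A ** A = mat 1"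
      by (auto simp: matrix_inv_def invertible_def intro: someI2_ex)
    have "(matrix_inv A ** B) *v v = r *\<^sub>R v \<longleftrightarrow> B *v v = r *\<^sub>R (A *v v)" for v
    proof
      assume "(matrix_inv A ** B) *v v = r *\<^sub>R v"
      then have "A *v ((matrix_inv A ** B) *v v) = A *v (r *\<^sub>R v)" by simp
      then show "B *v v = r *\<^sub>R (A *v v)"
        by (simp add: matrix_vector_mul_assoc matrix_mul_assoc inv matrix_vector_mult_scaleR)
    next
      assume "B *v v = r *\<^sub>R (A *v v)"
      then have "matrix_inv A *v (B *v v) = matrix_inv A *v (r *\<^sub>R (A *v v))" by simp
      then show "(matrix_inv A ** B) *v v = r *\<^sub>R v"
        by (simp add: matrix_vector_mul_assoc inv matrix_vector_mult_scaleR)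
    qed
    then show ?thesis by (simp add: N_mult)
  qed
  then have dim_ker: "dim {v. N *v v = 0} = 1"
    using segre by (simp add: num_jordan_blocks_def)
  have ker_sub: "subspace {v. N *v v = 0}"
    by (auto simp: subspace_def matrix_vector_right_distrib matrix_vector_mult_scaleR)
  obtain X where X: "N *v X = 0" "X \<noteq> 0"
  proof -
    have "\<not> {v. N *v v = 0} \<subseteq> {0}" using dim_ker dim_eq_0[of "{v. N *v v = 0}"] by simp
    then show ?thesis using that by blast
  qed
  have "span {X} = {v. N *v v = 0}"
  proof (rule subspace_dim_equal)
    show "span {X} \<subseteq> {v. N *v v = 0}" using X ker_sub by (intro span_minimal) auto
    show "dim {v. N *v v = 0} \<le> dim (span {X})"
      using dim_ker X by (simp add: dim_eq_card_independent[of "{X}"] dependent_single)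
  qed (use ker_sub in auto)
  then have N_ker: "\<exists>k. v = k *\<^sub>R X" if "N *v v = 0" for v
    using that by (force simp: span_singleton)

  let ?R = "smult (complex_of_real (det A)) ([:- of_real r, 1:]^2 * [:-z, 1:] * [:-cnj z, 1:])"
  have "complex_of_real (det (l *\<^sub>R A - B)) = poly ?R (of_real l)" for l :: real
    using roots[rule_format, of l] by (simp add: algebra_simps)
  moreover have "poly ?R z = 0" by simp
  ultimately obtain p q where pq: "p \<noteq> 0 \<or> q \<noteq> 0"
    "B *v p = Re z *\<^sub>R (A *v p) - Im z *\<^sub>R (A *v q)"
    "B *v q = Im z *\<^sub>R (A *v p) + Re z *\<^sub>R (A *v q)"
    by (rule nonreal_eigenvector)
  \<comment> \<open>Passing from \<open>B\<close> to \<open>N\<close> shifts every eigenvalue by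
    \<open>r\<close>: the double root moves to 0 and \<open>z\<close> to
    \<open>z - r\<close>.\<close>
  interpret pencil_211 A N X p q "Re z - r" "Im z"
  proof
    fix v l assume "N *v v = l *\<^sub>R (A *v v)" "v \<noteq> 0"
    then have "((l + r) *\<^sub>R A - B) *v v = 0"
      by (simp add: N_mult matrix_vector_mult_diff_rdistrib flip: scaleR_matrix_vector_assoc)
        (simp add: algebra_simps)
    then have "det ((l + r) *\<^sub>R A - B) = 0" using \<open>v \<noteq> 0\<close> det_nz_iff_ker by blast
    then show "l = 0" using det_nz[of "l + r"] by auto
  qed (use A_sym N_sym A_ker X N_ker pq nonreal in \<open>auto simp: N_mult algebra_simps\<close>)

  obtain c \<rho> \<sigma> e1 e2 e3 e4 where c: "c \<noteq> 0" and \<rho>: "\<rho> \<noteq> 0" and e1: "N *v e1 = 0"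
    and frame: "frame4 e1 e2 e3 e4"
    and forms: "\<And>x y s t. frame4.comb e1 e2 e3 e4 x y s t \<bullet> (N *v frame4.comb e1 e2 e3 e4 x y s t)
       = c * (y\<^sup>2 - s * t)"
    "\<And>x y s t. frame4.comb e1 e2 e3 e4 x y s t \<bullet> (A *v frame4.comb e1 e2 e3 e4 x y s t)
       = \<rho> * (2 * x * y + s\<^sup>2 - t\<^sup>2) + 2 * \<sigma> * (s * t - y\<^sup>2)"
    by (rule normal_form) blast
  interpret frame4 e1 e2 e3 e4 by (rule frame)

  have Id: "Id_pencil A B l = 2" if "l \<noteq> r" for l
  proof -
    have "l *\<^sub>R A - B = (l - r) *\<^sub>R A - N" by (simp add: N_def algebra_simps)
    then show ?thesis
      using num_pos_eigenvalues_pencil[OF A_sym N_sym forms \<rho>, of "l - r"] det_nz[OF that] that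
      by (simp add: Id_pencil_def)
  qed

  have B_mult: "B *v v = N *v v + r *\<^sub>R (A *v v)" for v by (simp add: N_mult)
  have qsic: "qsic A B = curve"
    by (rule qsic_eq_curve[where r = r, OF _ forms(2) \<rho> c]) (simp add: B_mult inner_add_right forms(1))
  have node: "proj_pt e1 \<in> curve"
    using \<phi>_in_curve[of 1 0] by (simp add: proj_pt_\<phi>_node)
  have "connected_component_set curve m = curve" if "m \<in> curve" for m
    using that connected_curve by (rule connected_component_eq_self[rotated])
  then have comps: "qsic_components A B = {curve}"
    unfolding qsic_components_def qsic using node by blast
  \<comment> \<open>As \<open>N\<close> kills \<open>e1\<close>, the gradient \<open>B e1\<close>
    equals \<open>r A e1\<close>, while \<open>A e1\<close> is nonzero; the Jacobian therefore has
    rank one.\<close>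
  have "double_point A B e1"
  proof -
    have "e1 \<bullet> (A *v e1) = 0" using forms(2)[of 1 0 0 0] by (simp add: comb_def)
    moreover have "dim (span {A *v e1, B *v e1}) = 1"
    proof -
      have "A *v e1 \<noteq> 0" using A_ker e1_nz by blast
      moreover have "span {A *v e1, B *v e1} = span {A *v e1}"
        by (subst insert_commute) (intro span_redundant, simp add: B_mult e1 span_mul span_base)
      ultimately show ?thesis by (simp add: dim_eq_card_independent[of "{A *v e1}"] dependent_single)
    qed
    ultimately show ?thesis
      using e1_nz by (simp add: double_point_def on_quadric_def B_mult e1)
  qed
  then have "crunode A B e1" by (rule crunode_if_qsic_eq_curve[OF qsic])
  then have "\<exists>K. qsic_components A B = {K} \<and> open_component K \<and>
      (\<exists>X. proj_pt X \<in> K \<and> crunode A B X)"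
    using comps open_component_curve node by blast
  then show ?thesis using Id by auto
qed

end
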